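(* Let $d\in\mathbb{N}$, let $\mu$ be a probability measure on $\mathbb{R}^d$, let $f\in L^2(\mathbb{R}^d,\mu)$ be real-valued, and assume that the probability density $\pi_a$ on $\mathbb{R}^d$ is continuous, strictly positive and decays at most polynomially. Then for any $\varepsilon>0$ there exist $n\in\mathbb{N}$ and an $\mathbb{R}^n$-valued $\sigma(\mathbf A,\mathbf B)$-measurable random vector $\boldsymbol W$ such that the quantum random neural network $F_{\boldsymbol W}$ (defined in the context) satisfies $$\mathbb{E}\left[\int_{\mathbb{R}^d}\left|F_{\boldsymbol W}(\boldsymbol x)-f(\boldsymbol x)\right|^2\mu(d\boldsymbol x)\right]^{1/2}\le\varepsilon.$$
   Context: "Decays at most polynomially" means: there are constants $c,k>0$ with $\pi_a(\boldsymbol\xi)\ge c(1+\|\boldsymbol\xi\|)^{-k}$ for all $\boldsymbol\xi\in\mathbb{R}^d$. Random parameters (for given $n\in\mathbb{N}$): $\mathbf B=(B^i)_{i=1,\dots,n}$ are i.i.d. with $\mathbb{P}(B^i=0)=\mathbb{P}(B^i=1)=\frac12$; $\mathbf A=(\mathbf A^i)_{i=1,\dots,n}$ are i.i.d. $\mathbb{R}^d$-valued with density $\pi_a$, $\mathbf A^i=(A^i_1,\dots,A^i_d)$; $\mathbf A$ and $\mathbf B$ are independent; $\sigma(\mathbf A,\mathbf B)$ is the $\sigma$-algebra they generate. Random quantum circuit. With $\mathtt H=\frac1{\sqrt2}\begin{pmatrix}1&1\\1&-1\end{pmatrix}$ and $\mathtt R_z(\alpha)=\begin{pmatrix}e^{-\mathrm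 i\alpha/2}&0\\0&e^{\mathrm i\alpha/2}\end{pmatrix}$, for $\boldsymbol x\in\mathbb{R}^d$ and $i=1,\dots,n$ let $\overline{\mathtt U}_1^{(i)}(\boldsymbol x)=\mathtt H\,\mathtt R_z(-\tfrac\pi2B^i)\,\mathtt R_z(-2\pi A^i_dx_d)\cdots\mathtt R_z(-2\pi A^i_1x_1)\,\mathtt H$. Let $\overline n_0\ge0$ be the smallest integer with $\log_2(2n+\overline n_0)\in\mathbb{N}$, $\overline{\mathfrak n}=\lceil\log_2(2n)\rceil$, $\overline N=2n+\overline n_0=2^{\overline{\mathfrak n}}$, and let $\overline{\mathtt U}(\boldsymbol x)\in\mathbb{C}^{\overline N\times\overline N}$ be block-diagonal with diagonal blocks $\overline{\mathtt U}_1^{(1)}(\boldsymbol x),\dots,\overline{\mathtt U}_1^{(n)}(\boldsymbol x)$ and the $\overline n_0\times\overline n_0$ identity. Let $|0\rangle,\dots,|\overline N-1\rangle$ be the computational (standard) basis of $\mathbb{C}^{\overline N}$, $|0\rangle=|0\rangle^{\otimes\overline{\mathfrak n}}$, and let $\overline{\mathtt V}$ be any unitary matrix mapping $|0\rangle^{\otimes\overline{\mathfrak n}}$ to $\frac1{\sqrt n}\sum_{i=0}^{n-1}|2i\rangle$. Put $\overline{\mathbb P}_k(\boldsymbol x)=|\langle k|\overline{\mathtt U}(\boldsymbol x)\overline{\mathtt V}|0\rangle^{\otimes\overline{\mathfrak n}}|^2$ for $k=0,\dots,\overline N-1$ (the probability of measuring $k$; it depends on the realisation of $\mathbf A,\mathbf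 B$). For $\boldsymbol w=(w_0,\dots,w_{n-1})\in\mathbb{R}^n$, $$F_{\boldsymbol w}(\boldsymbol x)=\sum_{j=0}^{n-1}w_j\left(2\overline{\mathbb P}_{2j}(\boldsymbol x)-\frac1n\right).$$ *)

theory Defs
  imports
    "HOL-Probability.Probability"
    "Jordan_Normal_Form.Schur_Decomposition"
begin

(* Both libraries use the infix dollar for component access; vec_nth (for real^'d) and
   vec_index (for complex vec) are written out below. *)
unbundle no vec_syntax

definition decays_at_most_polynomially :: "('a::real_normed_vector \<Rightarrow> real) \<Rightarrow> bool" where
  "decays_at_most_polynomially p \<longleftrightarrow>
     (\<exists>c>0. \<exists>k>0. \<forall>\<xi>. p \<xi> \<ge> c * (1 + norm \<xi>) powr (- k))"

(* The parameters of one network with n blocks: iid A^i with density p, iid fair B^i,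
   and the families A and B independent of each other.
   The latter is stated with the generated sigma-algebras because indep_var needs both
   variables to have the same type. *)
definition qrnn_parameters ::
  "'w measure \<Rightarrow> (real^'d \<Rightarrow> real) \<Rightarrow> nat \<Rightarrow> (nat \<Rightarrow> 'w \<Rightarrow> real^'d) \<Rightarrow> (nat \<Rightarrow> 'w \<Rightarrow> real) \<Rightarrow> bool" where
  "qrnn_parameters M p n A B \<longleftrightarrow>
     prob_space.indep_vars M (\<lambda>_. borel) A {1..n} \<and>
     (\<forall>i\<in>{1..n}. distributed M lborel (A i) (\<lambda>\<xi>. ennreal (p \<xi>))) \<and>
     prob_space.indep_vars M (\<lambda>_. borel) B {1..n} \<and>
     (\<forall>i\<in>{1..n}. measure M {\<omega>\<in>space M. B i \<omega> = 0} = 1/2 \<and>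
                  measure M {\<omega>\<in>space M. B i \<omega> = 1} = 1/2) \<and>
     prob_space.indep_set M
       (sets (vimage_algebra (space M) (\<lambda>\<omega>. \<lambda>i\<in>{1..n}. A i \<omega>) (PiM {1..n} (\<lambda>_. borel))))
       (sets (vimage_algebra (space M) (\<lambda>\<omega>. \<lambda>i\<in>{1..n}. B i \<omega>) (PiM {1..n} (\<lambda>_. borel))))"

definition sigma_AB ::
  "'w measure \<Rightarrow> nat \<Rightarrow> (nat \<Rightarrow> 'w \<Rightarrow> real^'d) \<Rightarrow> (nat \<Rightarrow> 'w \<Rightarrow> real) \<Rightarrow> 'w measure" where
  "sigma_AB M n A B =
     vimage_algebra (space M)
       (\<lambda>\<omega>. (\<lambda>i\<in>{1..n}. A i \<omega>, \<lambda>i\<in>{1..n}. B i \<omega>))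
       (PiM {1..n} (\<lambda>_. borel) \<Otimes>\<^sub>M PiM {1..n} (\<lambda>_. borel))"

definition hadamard :: "complex mat" where
  "hadamard = (1 / complex_of_real (sqrt 2)) \<cdot>\<^sub>m mat_of_rows_list 2 [[1, 1], [1, - 1]]"

definition Rz :: "real \<Rightarrow> complex mat" where
  "Rz \<alpha> = mat_of_rows_list 2
     [[exp (- \<i> * complex_of_real \<alpha> / 2), 0], [0, exp (\<i> * complex_of_real \<alpha> / 2)]]"

(* The linear order on the finite index type 'd numbers the coordinates 1,...,d; the list is
   reversed because the factor of the last coordinate is the leftmost one. *)
definition U1 :: "real^'d::{finite,linorder} \<Rightarrow> real \<Rightarrow> real^'d::_ \<Rightarrow> complex mat" where
  "U1 a b x =
     hadamard * Rz (- (pi / 2) * b) *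
     foldr (*) (map (\<lambda>k. Rz (- 2 * pi * vec_nth a k * vec_nth x k))
                 (rev (sorted_list_of_set UNIV))) (1\<^sub>m 2) *
     hadamard"

definition n0_bar :: "nat \<Rightarrow> nat" where
  "n0_bar n = (LEAST m. log 2 (real (2 * n + m)) \<in> \<nat>)"

definition N_bar :: "nat \<Rightarrow> nat" where
  "N_bar n = 2 * n + n0_bar n"

definition U_bar ::
  "nat \<Rightarrow> (nat \<Rightarrow> real^'d::{finite,linorder}) \<Rightarrow> (nat \<Rightarrow> real) \<Rightarrow> real^'d::_ \<Rightarrow> complex mat" where
  "U_bar n a b x =
     diag_block_mat (map (\<lambda>i. U1 (a i) (b i) x) [1..<n+1] @ [1\<^sub>m (n0_bar n)])"

definition ket :: "nat \<Rightarrow> nat \<Rightarrow> complex vec" where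
  "ket n k = unit_vec (N_bar n) k"

definition unitary_mat :: "nat \<Rightarrow> complex mat \<Rightarrow> bool" where
  "unitary_mat N V \<longleftrightarrow>
     V \<in> carrier_mat N N \<and> V * mat_adjoint V = 1\<^sub>m N \<and> mat_adjoint V * V = 1\<^sub>m N"

(* The vector n^(-1/2) * (|0> + |2> + ... + |2n-2>), written componentwise. *)
definition uniform_even_state :: "nat \<Rightarrow> complex vec" where
  "uniform_even_state n =
     vec (N_bar n) (\<lambda>j. 1 / complex_of_real (sqrt (real n)) * (\<Sum>i<n. vec_index (ket n (2 * i)) j))"

definition state_preparation :: "nat \<Rightarrow> complex mat \<Rightarrow> bool" where
  "state_preparation n V \<longleftrightarrow> unitary_mat (N_bar n) V \<and> V *\<^sub>v ket n 0 = uniform_even_state n"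

definition P_bar ::
  "nat \<Rightarrow> complex mat \<Rightarrow> (nat \<Rightarrow> real^'d::{finite,linorder}) \<Rightarrow> (nat \<Rightarrow> real) \<Rightarrow> real^'d::_ \<Rightarrow> nat \<Rightarrow> real" where
  "P_bar n V a b x k = (cmod (((U_bar n a b x * V) *\<^sub>v ket n 0) \<bullet>c ket n k))\<^sup>2"

definition qrnn ::
  "nat \<Rightarrow> complex mat \<Rightarrow> (nat \<Rightarrow> real^'d::{finite,linorder}) \<Rightarrow> (nat \<Rightarrow> real) \<Rightarrow>
   (nat \<Rightarrow> real) \<Rightarrow> real^'d::_ \<Rightarrow> real" where
  "qrnn n V a b w x = (\<Sum>j<n. w j * (2 * P_bar n V a b x (2 * j) - 1 / real n))"

end

theory Submission
  imports Defs
begin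

text \<open>The network is the random feature average
  \<open>1/n * \<Sum>j. w\<^sub>j * cos (2 * pi * (A\<^sup>j \<bullet> x) + pi/2 * B\<^sup>j)\<close>. For a bounded function \<open>G\<close> the
  weights \<open>w\<^sub>j = G (A\<^sup>j, B\<^sup>j)\<close> make it a Monte Carlo estimate, with mean square error \<open>O(1/n)\<close>, of the
  mean \<open>x \<mapsto> E[G (A, B) * cos (2 * pi * (A \<bullet> x) + pi/2 * B)]\<close>. These means are dense in
  \<open>L\<^sup>2(\<mu>)\<close>: normalised indicators \<open>G\<close> of small neighbourhoods of \<open>(a, b)\<close> yield each single wave in
  the limit because \<open>\<pi>\<^sub>a\<close> is positive, and trigonometric polynomials are dense by Stone-Weierstrass.\<close>

section \<open>The circuit as a sum of cosines\<close>

text \<open>Two obstacles shape the argument. The law of the frequencies has a density, so no single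
  frequency carries mass and a wave is only a limit of means; this limit is not uniform in x,
  because the Lipschitz constant of a wave in its frequency grows with the norm of x. Moreover \<mu>
  lives on the whole space, so uniform approximation on a compact set says nothing about the tail.
  Both are met by one device: keep the approximants uniformly bounded and apply dominated
  convergence for the finite measure \<mu>. The coin supplies the second quadrature: a shift by pi/2
  turns cos into -sin, and these two span the waves of every phase. Each weight depends only on the
  parameters of its own block, so the summands are iid, and boundedness of \<open>G\<close> makes
  the Monte Carlo bound uniform in x. Hence \<open>n\<close> can be chosen once \<open>G\<close> is
  fixed, and exchanging the two integrals reduces the claim to an estimate at a fixed x.\<close>

lemma Rz_eq:
  "Rz t = Matrix.mat 2 2 (\<lambda>(i, j). if i \<noteq> j then 0
     else if i = 0 then exp (- \<i> * complex_of_real t / 2) else exp (\<i> * complex_of_real t / 2))"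
  unfolding Rz_def mat_of_rows_list_def
  by (rule eq_matI) (auto simp: less_Suc_eq numeral_2_eq_2)

lemma hadamard_eq:
  "hadamard = Matrix.mat 2 2 (\<lambda>(i, j). (if i = 1 \<and> j = 1 then - 1 else 1) / complex_of_real (sqrt 2))"
  unfolding hadamard_def mat_of_rows_list_def
  by (rule eq_matI) (auto simp: less_Suc_eq numeral_2_eq_2)

lemma Rz_carrier: "Rz t \<in> carrier_mat 2 2"
  by (simp add: Rz_eq)

lemma hadamard_carrier: "hadamard \<in> carrier_mat 2 2"
  by (simp add: hadamard_eq)

text \<open>The z-rotations form a one-parameter group. This collapses the product over coordinates
  in \<open>U1\<close> to a single rotation, whose angle contains the inner product of frequency and
  input.\<close>

lemma Rz_mult: "Rz s * Rz t = Rz (s + t)"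
proof (rule eq_matI)
  fix i j assume "i < dim_row (Rz (s + t))" "j < dim_col (Rz (s + t))"
  hence "i < 2" "j < 2" by (auto simp: Rz_eq)
  thus "(Rz s * Rz t) $$ (i, j) = Rz (s + t) $$ (i, j)"
    by (auto simp: Rz_eq scalar_prod_def less_2_cases_iff numeral_2_eq_2 exp_add[symmetric]
        algebra_simps add_divide_distrib diff_divide_distrib)
qed (auto simp: Rz_eq)

lemma Rz_0: "Rz 0 = 1\<^sub>m 2"
  by (rule eq_matI) (auto simp: Rz_eq)

lemma foldr_Rz: "foldr (*) (map (\<lambda>k. Rz (g k)) ks) (1\<^sub>m 2) = Rz (\<Sum>k\<leftarrow>ks. g k)"
  by (induction ks) (simp_all add: Rz_0 Rz_mult)

text \<open>Conjugation with \<open>hadamard\<close> averages the two opposite phases on the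
  diagonal. Only this entry is ever needed: the prepared state lives on even basis vectors and the
  readout is at even positions.\<close>

lemma hadamard_Rz_hadamard_00: "(hadamard * Rz t * hadamard) $$ (0, 0) = complex_of_real (cos (t / 2))"
proof -
  have sq: "complex_of_real (sqrt 2) * complex_of_real (sqrt 2) = 2"
    by (simp flip: of_real_mult)
  have "(hadamard * Rz t * hadamard) $$ (0, 0) =
      (exp (- \<i> * complex_of_real t / 2) + exp (\<i> * complex_of_real t / 2)) / 2"
    by (simp add: hadamard_eq Rz_eq scalar_prod_def numeral_2_eq_2 field_simps sq)
  also have "\<dots> = complex_of_real (cos (t / 2))"
    by (simp add: cos_exp_eq add.commute flip: cos_of_real)
  finally show ?thesis .
qed

lemma U1_eq: "U1 a b x = hadamard * Rz (- (pi / 2 * b + 2 * pi * inner a x)) * hadamard"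
proof -
  have "(\<Sum>k\<leftarrow>rev (sorted_list_of_set UNIV). - 2 * pi * vec_nth a k * vec_nth x k) =
      (\<Sum>k\<in>UNIV. - 2 * pi * vec_nth a k * vec_nth x k)"
    by (simp add: rev_map[symmetric] sum_list_distinct_conv_sum_set)
  also have "\<dots> = - (2 * pi * inner a x)"
    by (simp add: inner_vec_def sum_distrib_left sum_negf mult.assoc)
  finally have s: "(\<Sum>k\<leftarrow>rev (sorted_list_of_set UNIV). - 2 * pi * vec_nth a k * vec_nth x k) =
      - (2 * pi * inner a x)" .
  have "hadamard * Rz (- (pi / 2) * b) * Rz (- (2 * pi * inner a x)) =
      hadamard * (Rz (- (pi / 2) * b) * Rz (- (2 * pi * inner a x)))"
    by (rule assoc_mult_mat[OF hadamard_carrier Rz_carrier Rz_carrier])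
  thus ?thesis
    unfolding U1_def foldr_Rz s by (simp add: Rz_mult)
qed

lemma U1_carrier: "U1 a b x \<in> carrier_mat 2 2"
  unfolding U1_eq using Rz_carrier hadamard_carrier by (intro mult_carrier_mat)

text \<open>Induction on the blocks: the head occupies the indices 0 and 1, so passing to the tail
  shifts an even index by 2. The last block \<open>C\<close> stands for the identity padding, which
  the first n even positions never reach.\<close>

lemma diag_block_mat_2x2_index:
  assumes "\<And>A. A \<in> set As \<Longrightarrow> A \<in> carrier_mat 2 2" and "i < length As" "j < length As"
  shows "diag_block_mat (As @ [C]) $$ (2 * i, 2 * j) = (if i = j then (As ! i) $$ (0, 0) else 0)"
  using assms
proof (induction As arbitrary: i j)
  case (Cons A As)
  define D where "D = diag_block_mat (As @ [C])"
  have dims: "map dim_row As = map (\<lambda>_. 2) As" "map dim_col As = map (\<lambda>_. 2) As"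
    using Cons.prems(1) by auto
  have D: "2 * length As \<le> dim_row D" "2 * length As \<le> dim_col D"
    by (auto simp: D_def dim_diag_block_mat dims sum_list_triv)
  have A: "dim_row A = 2" "dim_col A = 2"
    using Cons.prems(1)[of A] by auto
  have IH: "D $$ (2 * k, 2 * l) = (if k = l then (As ! k) $$ (0, 0) else 0)"
    if "k < length As" "l < length As" for k l
    unfolding D_def using Cons that by auto
  show ?case
    using Cons.prems(2,3) D A
    by (cases i; cases j) (auto simp: Let_def D_def[symmetric] IH)
qed simp

text \<open>The amplitude at position 2j is the cosine of half the angle divided by sqrt n.
  Measurement squares it, and the affine readout undoes the square by the double-angle formula. The
  shift j + 1 arises because blocks are numbered from 1 and weights from 0.\<close>

lemma qrnn_eq_cosine_sum:
  assumes n: "n \<ge> 1" and V: "state_preparation n V"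
  shows "qrnn n V a b w x =
    (\<Sum>j<n. w j * cos (2 * pi * inner (a (j + 1)) x + pi / 2 * b (j + 1))) / real n"
proof -
  define U where "U = U_bar n a b x"
  define N where "N = N_bar n"
  define As where "As = map (\<lambda>i. U1 (a i) (b i) x) [1..<n+1]"
  have As: "A \<in> carrier_mat 2 2" if "A \<in> set As" for A
    using that U1_carrier by (auto simp: As_def)
  have len: "length As = n" by (simp add: As_def)
  have U_As: "U = diag_block_mat (As @ [1\<^sub>m (n0_bar n)])"
    by (simp add: U_def U_bar_def As_def)
  have dims: "map dim_row As = map (\<lambda>_. 2) As" "map dim_col As = map (\<lambda>_. 2) As"
    using As by auto
  have UN: "U \<in> carrier_mat N N"
    unfolding U_As by (intro carrier_matI)
      (simp_all add: dim_diag_block_mat dims sum_list_triv len N_def N_bar_def)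
  have n2: "2 * j < N" if "j < n" for j using that by (simp add: N_def N_bar_def)
  have U_idx: "U $$ (2 * i, 2 * j) =
      (if i = j then complex_of_real (cos (pi * inner (a (j+1)) x + pi / 4 * b (j+1))) else 0)"
    if "i < n" "j < n" for i j
  proof -
    have "U $$ (2 * i, 2 * j) = (if i = j then (As ! i) $$ (0, 0) else 0)"
      unfolding U_As using that As by (intro diag_block_mat_2x2_index) (auto simp: len)
    moreover have "(As ! j) $$ (0, 0) = complex_of_real (cos (pi * inner (a (j+1)) x + pi / 4 * b (j+1)))"
    proof -
      have "As ! j = U1 (a (j+1)) (b (j+1)) x"
        using that by (simp add: As_def nth_append del: upt_Suc)
      moreover have "- (pi / 2 * b (j+1) + 2 * pi * inner (a (j+1)) x) / 2 =
          - (pi * inner (a (j+1)) x + pi / 4 * b (j+1))"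
        by (simp add: field_simps)
      ultimately show ?thesis
        unfolding U1_eq by (simp only: hadamard_Rz_hadamard_00 cos_minus)
    qed
    ultimately show ?thesis by simp
  qed
  have P: "2 * P_bar n V a b x (2 * j) - 1 / real n =
      cos (2 * pi * inner (a (j+1)) x + pi / 2 * b (j+1)) / real n" if j: "j < n" for j
  proof -
    define c where "c = complex_of_real (1 / sqrt (real n))"
    define u where "u = uniform_even_state n"
    let ?t = "pi * inner (a (j+1)) x + pi / 4 * b (j+1)"
    have u: "u \<in> carrier_vec N" by (simp add: u_def uniform_even_state_def N_def)
    have VN: "V \<in> carrier_mat N N" and Vu: "V *\<^sub>v ket n 0 = u"
      using V by (auto simp: state_preparation_def unitary_mat_def N_def u_def)
    have ket: "ket n k \<in> carrier_vec N" for k by (simp add: ket_def N_def)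
    have "(U * V) *\<^sub>v ket n 0 = U *\<^sub>v u"
      using assoc_mult_mat_vec[OF UN VN ket] Vu by simp
    hence "((U * V) *\<^sub>v ket n 0) \<bullet>c ket n (2 * j) = (U *\<^sub>v u) \<bullet>c ket n (2 * j)" by simp
    also have "\<dots> = vec_index (U *\<^sub>v u) (2 * j)"
    proof -
      have "conjugate (ket n (2 * j)) = ket n (2 * j)"
        by (rule eq_vecI) (auto simp: ket_def unit_vec_def)
      thus ?thesis
        using n2[OF j] UN u by (simp add: ket_def N_def scalar_prod_right_unit)
    qed
    also have "\<dots> = (\<Sum>k<N. U $$ (2 * j, k) * vec_index u k)"
      using n2[OF j] UN u by (auto simp: scalar_prod_def atLeast0LessThan)
    also have "\<dots> = (\<Sum>k<N. \<Sum>i<n. U $$ (2 * j, k) * (if k = 2 * i then c else 0))"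
    proof (rule sum.cong[OF refl])
      fix k assume k: "k \<in> {..<N}"
      have "vec_index u k = c * (\<Sum>i<n. if k = 2 * i then 1 else 0)"
        using k n2 by (auto simp: u_def uniform_even_state_def ket_def N_def c_def unit_vec_def
            intro!: sum.cong)
      thus "U $$ (2 * j, k) * vec_index u k = (\<Sum>i<n. U $$ (2 * j, k) * (if k = 2 * i then c else 0))"
        by (auto simp: sum_distrib_left intro!: sum.cong)
    qed
    also have "\<dots> = (\<Sum>i<n. \<Sum>k<N. U $$ (2 * j, k) * (if k = 2 * i then c else 0))"
      by (rule sum.swap)
    \<comment> \<open>The inner sum over \<open>k\<close> picks out \<open>k = 2 * i\<close>, which
      lies below \<open>N\<close>. The block-diagonal form then leaves only
      \<open>i = j\<close>.\<close>
    also have "\<dots> = (\<Sum>i<n. U $$ (2 * j, 2 * i) * c)"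
      using n2 by (auto intro!: sum.cong simp: if_distrib cong: if_cong)
    also have "\<dots> = (\<Sum>i<n. if i = j then complex_of_real (cos ?t) * c else 0)"
      using j U_idx by (intro sum.cong) auto
    also have "\<dots> = complex_of_real (cos ?t * (1 / sqrt (real n)))"
      using j by (simp add: c_def)
    finally have "P_bar n V a b x (2 * j) = (cos ?t)\<^sup>2 / real n"
      by (simp add: P_bar_def U_def[symmetric] norm_mult norm_divide power_mult_distrib
          power_divide)
    moreover have "cos (2 * pi * inner (a (j+1)) x + pi / 2 * b (j+1)) = 2 * (cos ?t)\<^sup>2 - 1"
      using cos_double_cos[of ?t] by (simp add: algebra_simps)
    ultimately show ?thesis by (simp add: diff_divide_distrib)
  qed
  show ?thesis
    unfolding qrnn_def by (simp add: P sum_divide_distrib)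
qed

section \<open>Density of trigonometric polynomials in the square-integrable functions\<close>

lemma square_sum_le: "(a + b)\<^sup>2 \<le> 2 * a\<^sup>2 + 2 * (b::real)\<^sup>2"
  using sum_squares_bound[of a b] by (simp add: power2_sum)

text \<open>Serves as the triangle inequality of L2. Working with squared distances avoids roots and
  integrability side conditions; the price is a factor 2, which is why two errors of
  \<open>e / 4\<close> add up to \<open>e\<close> below.\<close>

lemma nn_integral_square_sum_le:
  fixes f g :: "'a \<Rightarrow> real"
  assumes [measurable]: "f \<in> borel_measurable M" "g \<in> borel_measurable M"
    and "(\<integral>\<^sup>+x. ennreal ((f x)\<^sup>2) \<partial>M) \<le> ennreal a" "(\<integral>\<^sup>+x. ennreal ((g x)\<^sup>2) \<partial>M) \<le> ennreal b"
    and "0 \<le> a" "0 \<le> b"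
  shows "(\<integral>\<^sup>+x. ennreal ((f x + g x)\<^sup>2) \<partial>M) \<le> ennreal (2 * a + 2 * b)"
proof -
  have "(\<integral>\<^sup>+x. ennreal ((f x + g x)\<^sup>2) \<partial>M) \<le>
      (\<integral>\<^sup>+x. 2 * ennreal ((f x)\<^sup>2) + 2 * ennreal ((g x)\<^sup>2) \<partial>M)"
  proof (rule nn_integral_mono)
    fix x
    have "ennreal ((f x + g x)\<^sup>2) \<le> ennreal (2 * (f x)\<^sup>2 + 2 * (g x)\<^sup>2)"
      by (intro ennreal_leI square_sum_le)
    thus "ennreal ((f x + g x)\<^sup>2) \<le> 2 * ennreal ((f x)\<^sup>2) + 2 * ennreal ((g x)\<^sup>2)"
      by (simp add: ennreal_plus ennreal_mult)
  qed
  also have "\<dots> = 2 * (\<integral>\<^sup>+x. ennreal ((f x)\<^sup>2) \<partial>M) + 2 * (\<integral>\<^sup>+x. ennreal ((g x)\<^sup>2) \<partial>M)"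
    by (simp add: nn_integral_add nn_integral_cmult)
  also have "\<dots> \<le> 2 * ennreal a + 2 * ennreal b"
    using assms by (intro add_mono mult_left_mono) auto
  also have "\<dots> = ennreal (2 * a + 2 * b)"
    using assms by (simp add: ennreal_plus ennreal_mult)
  finally show ?thesis .
qed

section \<open>The mean-square closure of a linear space of functions\<close>

locale L2_linear_space = finite_measure M for M :: "'a measure" +
  fixes H :: "('a \<Rightarrow> real) set"
  assumes H_measurable: "h \<in> H \<Longrightarrow> h \<in> borel_measurable M"
    and H_add: "g \<in> H \<Longrightarrow> h \<in> H \<Longrightarrow> (\<lambda>x. g x + h x) \<in> H"
    and H_scale: "h \<in> H \<Longrightarrow> (\<lambda>x. c * h x) \<in> H"
begin

text \<open>Membership in the L2-closure of \<open>H\<close>. Only the difference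
  \<open>h - f\<close> is measured, so neither \<open>h\<close> nor \<open>f\<close> has to be shown
  square-integrable.\<close>

definition approximable :: "('a \<Rightarrow> real) \<Rightarrow> bool" where
  "approximable f \<longleftrightarrow> f \<in> borel_measurable M \<and>
     (\<forall>e>0. \<exists>h\<in>H. (\<integral>\<^sup>+x. ennreal ((h x - f x)\<^sup>2) \<partial>M) \<le> ennreal e)"

lemma approximable_measurable: "approximable f \<Longrightarrow> f \<in> borel_measurable M"
  by (simp add: approximable_def)

lemma approximableE:
  assumes "approximable f" "e > 0"
  obtains h where "h \<in> H" "(\<integral>\<^sup>+x. ennreal ((h x - f x)\<^sup>2) \<partial>M) \<le> ennreal e"
  using assms by (auto simp: approximable_def)

lemma approximable_base: "h \<in> H \<Longrightarrow> approximable h"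
  using H_measurable by (auto simp: approximable_def intro!: bexI[of _ h])

lemma approximable_add:
  assumes f: "approximable f" and g: "approximable g"
  shows "approximable (\<lambda>x. f x + g x)"
  unfolding approximable_def
proof (intro conjI allI impI)
  show "(\<lambda>x. f x + g x) \<in> borel_measurable M"
    by (intro borel_measurable_add approximable_measurable f g)
  fix e :: real assume "e > 0"
  hence e: "e / 4 > 0" by simp
  obtain h where h: "h \<in> H" "(\<integral>\<^sup>+x. ennreal ((h x - f x)\<^sup>2) \<partial>M) \<le> ennreal (e / 4)"
    using approximableE[OF f e] .
  obtain k where k: "k \<in> H" "(\<integral>\<^sup>+x. ennreal ((k x - g x)\<^sup>2) \<partial>M) \<le> ennreal (e / 4)"
    using approximableE[OF g e] .
  have "(\<integral>\<^sup>+x. ennreal (((h x - f x) + (k x - g x))\<^sup>2) \<partial>M) \<le> ennreal (2 * (e / 4) + 2 * (e / 4))"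
    using h k e f g H_measurable[OF h(1)] H_measurable[OF k(1)]
    by (intro nn_integral_square_sum_le) (auto dest: approximable_measurable)
  moreover have "h x - f x + (k x - g x) = h x + k x - (f x + g x)" for x by simp
  ultimately show "\<exists>h\<in>H. (\<integral>\<^sup>+x. ennreal ((h x - (f x + g x))\<^sup>2) \<partial>M) \<le> ennreal e"
    using H_add[OF h(1) k(1)] by (intro bexI[of _ "\<lambda>x. h x + k x"]) auto
qed

lemma approximable_scale:
  assumes f: "approximable f"
  shows "approximable (\<lambda>x. c * f x)"
  unfolding approximable_def
proof (intro conjI allI impI)
  have [measurable]: "f \<in> borel_measurable M" using f by (rule approximable_measurable)
  show "(\<lambda>x. c * f x) \<in> borel_measurable M" by simp
  fix e :: real assume "e > 0"
  \<comment> \<open>Dividing the tolerance by the square of \<open>c\<close> plus 1 covers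
    \<open>c = 0\<close> without a case split.\<close>
  have c: "c\<^sup>2 + 1 > 0" by (rule add_nonneg_pos) auto
  hence "e / (c\<^sup>2 + 1) > 0" using \<open>e > 0\<close> by (intro divide_pos_pos)
  then obtain h where h: "h \<in> H" "(\<integral>\<^sup>+x. ennreal ((h x - f x)\<^sup>2) \<partial>M) \<le> ennreal (e / (c\<^sup>2 + 1))"
    using approximableE[OF f] by blast
  have [measurable]: "h \<in> borel_measurable M" using H_measurable[OF h(1)] .
  have "(\<integral>\<^sup>+x. ennreal ((c * h x - c * f x)\<^sup>2) \<partial>M) = (\<integral>\<^sup>+x. ennreal (c\<^sup>2) * ennreal ((h x - f x)\<^sup>2) \<partial>M)"
    by (simp add: ennreal_mult[symmetric] power_mult_distrib[symmetric] right_diff_distrib)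
  also have "\<dots> = ennreal (c\<^sup>2) * (\<integral>\<^sup>+x. ennreal ((h x - f x)\<^sup>2) \<partial>M)"
    by (simp add: nn_integral_cmult)
  also have "\<dots> \<le> ennreal (c\<^sup>2) * ennreal (e / (c\<^sup>2 + 1))"
    using h(2) by (rule mult_left_mono) simp
  also have "\<dots> = ennreal (c\<^sup>2 * e / (c\<^sup>2 + 1))"
    using \<open>e > 0\<close> by (simp add: ennreal_mult[symmetric])
  also have "\<dots> \<le> ennreal e"
  proof (rule ennreal_leI)
    show "c\<^sup>2 * e / (c\<^sup>2 + 1) \<le> e"
      using \<open>e > 0\<close> by (subst pos_divide_le_eq[OF c]) (auto simp: algebra_simps)
  qed
  finally show "\<exists>h\<in>H. (\<integral>\<^sup>+x. ennreal ((h x - c * f x)\<^sup>2) \<partial>M) \<le> ennreal e"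
    using H_scale[OF h(1), of c] by (intro bexI[of _ "\<lambda>x. c * h x"])
qed

text \<open>\<open>H\<close> is not assumed to be nonempty, so the empty sum needs a witness
  \<open>z\<close>, which is scaled by 0.\<close>

lemma approximable_sum:
  assumes "finite S" "approximable z" "\<And>i. i \<in> S \<Longrightarrow> approximable (F i)"
  shows "approximable (\<lambda>x. \<Sum>i\<in>S. F i x)"
  using assms(1,3)
proof (induction S rule: finite_induct)
  case empty
  show ?case using approximable_scale[OF assms(2), of 0] by simp
qed (simp add: approximable_add)

text \<open>Dominated convergence puts some \<open>g i\<close> close to \<open>f\<close>, and an
  element of \<open>H\<close> close to that \<open>g i\<close> is then close to \<open>f\<close>.
  Domination is required of the squared differences only, so that uniform bounds and monotone limits
  are both covered.\<close>

lemma approximable_dominated_limit: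
  assumes g: "\<And>i. approximable (g i)"
    and lim: "\<And>x. x \<in> space M \<Longrightarrow> (\<lambda>i. g i x) \<longlonglongrightarrow> f x"
    and le: "\<And>i x. x \<in> space M \<Longrightarrow> (g i x - f x)\<^sup>2 \<le> w x"
    and w: "integrable M w"
  shows "approximable f"
  unfolding approximable_def
proof (intro conjI allI impI)
  have [measurable]: "g i \<in> borel_measurable M" for i using g by (rule approximable_measurable)
  show [measurable]: "f \<in> borel_measurable M"
    by (rule borel_measurable_LIMSEQ_real[OF lim]) auto
  have [measurable]: "w \<in> borel_measurable M" using w by simp
  fix e :: real assume e: "e > 0"
  have "(\<lambda>i. \<integral>\<^sup>+x. ennreal ((g i x - f x)\<^sup>2) \<partial>M) \<longlonglongrightarrow> (\<integral>\<^sup>+x. 0 \<partial>M)"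
  proof (rule nn_integral_dominated_convergence)
    have w0: "AE x in M. 0 \<le> w x"
      using le[of _ 0] by (intro AE_I2 order.trans[OF zero_le_power2])
    show "(\<integral>\<^sup>+x. ennreal (w x) \<partial>M) < \<infinity>"
      using nn_integral_eq_integral[OF w w0] by simp
    show "AE x in M. (\<lambda>i. ennreal ((g i x - f x)\<^sup>2)) \<longlonglongrightarrow> 0"
    proof (rule AE_I2)
      fix x assume "x \<in> space M"
      hence "(\<lambda>i. (g i x - f x)\<^sup>2) \<longlonglongrightarrow> 0\<^sup>2"
        using lim[of x] by (intro tendsto_power) (simp add: LIM_zero)
      thus "(\<lambda>i. ennreal ((g i x - f x)\<^sup>2)) \<longlonglongrightarrow> 0"
        using tendsto_ennrealI by fastforce
    qed
  qed (auto intro!: AE_I2 ennreal_leI le)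
  hence "eventually (\<lambda>i. (\<integral>\<^sup>+x. ennreal ((g i x - f x)\<^sup>2) \<partial>M) < ennreal (e / 4)) sequentially"
    using e by (intro order_tendstoD(2)[of _ "\<integral>\<^sup>+x. 0 \<partial>M"]) auto
  then obtain i where i: "(\<integral>\<^sup>+x. ennreal ((g i x - f x)\<^sup>2) \<partial>M) < ennreal (e / 4)"
    by (auto simp: eventually_sequentially)
  have "e / 4 > 0" using e by simp
  then obtain h where h: "h \<in> H" "(\<integral>\<^sup>+x. ennreal ((h x - g i x)\<^sup>2) \<partial>M) \<le> ennreal (e / 4)"
    using approximableE[OF g[of i]] by blast
  have [measurable]: "h \<in> borel_measurable M" using H_measurable[OF h(1)] .
  have "(\<integral>\<^sup>+x. ennreal (((h x - g i x) + (g i x - f x))\<^sup>2) \<partial>M) \<le> ennreal (2 * (e / 4) + 2 * (e / 4))"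
    using h i e by (intro nn_integral_square_sum_le) auto
  thus "\<exists>h\<in>H. (\<integral>\<^sup>+x. ennreal ((h x - f x)\<^sup>2) \<partial>M) \<le> ennreal e"
    using h(1) by (intro bexI[of _ h]) auto
qed

lemma approximable_bounded_limit:
  assumes "\<And>i. approximable (g i)"
    and "\<And>x. x \<in> space M \<Longrightarrow> (\<lambda>i. g i x) \<longlonglongrightarrow> f x"
    and le: "\<And>i x. x \<in> space M \<Longrightarrow> \<bar>g i x - f x\<bar> \<le> K"
  shows "approximable f"
proof (rule approximable_dominated_limit[OF assms(1,2)])
  show "(g i x - f x)\<^sup>2 \<le> K\<^sup>2" if "x \<in> space M" for i x
    using le[OF that] by (metis abs_ge_zero abs_of_nonneg abs_le_square_iff order.trans)
qed auto

text \<open>Standard measure-theoretic induction from indicators to nonnegative functions, then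
  splitting into positive and negative part. Square-integrability is carried through the induction
  as a premise, so each case must first pass it down to the smaller functions.\<close>

lemma approximable_L2:
  assumes sets: "\<And>S. S \<in> sets M \<Longrightarrow> approximable (indicator S)"
    and f: "f \<in> borel_measurable M" and f2: "integrable M (\<lambda>x. (f x)\<^sup>2)"
  shows "approximable f"
proof -
  have nonneg: "approximable u"
    if u: "u \<in> borel_measurable M" "\<And>x. 0 \<le> u x" and u2: "integrable M (\<lambda>x. (u x)\<^sup>2)" for u
    using u u2
  proof (induction rule: borel_measurable_induct_real)
    case (set S)
    thus ?case using sets by simp
  next
    case (mult u c)
    show ?case
    \<comment> \<open>For \<open>c = 0\<close> the premise on \<open>c * u\<close> gives no
      integrability of the square of \<open>u\<close>, so the induction hypothesis is out of reach;
      the product is 0 anyway.\<close>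
    proof (cases "c = 0")
      case True
      thus ?thesis using approximable_scale[OF sets[of "{}"], of 0] by simp
    next
      case False
      hence "integrable M (\<lambda>x. (u x)\<^sup>2)"
        using mult.prems by (simp add: power_mult_distrib)
      thus ?thesis using mult by (intro approximable_scale) auto
    qed
  next
    case (add u v)
    note [measurable] = add.hyps(1,3)
    have "integrable M (\<lambda>x. (u x)\<^sup>2)" "integrable M (\<lambda>x. (v x)\<^sup>2)"
      by (rule Bochner_Integration.integrable_bound[OF add.prems];
          use add.hyps in \<open>auto intro!: power_mono\<close>)+
    thus ?case using add by (intro approximable_add) auto
  next
    case (seq U)
    have le: "U i x \<le> u x" if "x \<in> space M" for i x
      using seq.hyps(3,4) that by (intro incseq_le) (auto simp: incseq_def le_fun_def)
    have [measurable]: "U i \<in> borel_measurable M" for i using seq.hyps(1) .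
    have "integrable M (\<lambda>x. (U i x)\<^sup>2)" for i
      using le seq.hyps(2) by (intro Bochner_Integration.integrable_bound[OF seq.prems])
        (auto intro!: power_mono)
    hence "approximable (U i)" for i using seq by auto
    thus ?case
    proof (rule approximable_dominated_limit[OF _ seq.hyps(4) _ seq.prems])
      fix i x assume x: "x \<in> space M"
      \<comment> \<open>Since \<open>U i\<close> lies between 0 and \<open>u\<close>, the square of
        \<open>u\<close> is itself the dominating function.\<close>
      have "\<bar>U i x - u x\<bar> \<le> \<bar>u x\<bar>"
        using le[OF x, of i] seq.hyps(2)[of i x] by simp
      thus "(U i x - u x)\<^sup>2 \<le> (u x)\<^sup>2" by (simp add: abs_le_square_iff)
    qed
  qed
  have *: "integrable M (\<lambda>x. (max 0 (s * f x))\<^sup>2)" if "\<bar>s\<bar> = 1" for s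
  proof (rule Bochner_Integration.integrable_bound[OF f2])
    have "s = 1 \<or> s = - 1" using that by linarith
    thus "AE x in M. norm ((max 0 (s * f x))\<^sup>2) \<le> norm ((f x)\<^sup>2)"
      by (auto simp: max_def)
  qed (use f in measurable)
  have "approximable (\<lambda>x. max 0 (1 * f x))" "approximable (\<lambda>x. max 0 (- 1 * f x))"
    by (rule nonneg; use f *[of 1] *[of "-1"] in simp)+
  hence "approximable (\<lambda>x. max 0 (1 * f x) + - 1 * max 0 (- 1 * f x))"
    by (intro approximable_add approximable_scale)
  moreover have "(\<lambda>x. max 0 (1 * f x) + - 1 * max 0 (- 1 * f x)) = f"
    by (auto simp: max_def)
  ultimately show ?thesis by simp
qed

end

section \<open>Trigonometric polynomials and their density by Stone-Weierstrass\<close>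

inductive trig_poly :: "('a::real_inner \<Rightarrow> real) \<Rightarrow> bool" where
  wave: "trig_poly (\<lambda>x. cos (inner a x + s))"
| add: "trig_poly f \<Longrightarrow> trig_poly g \<Longrightarrow> trig_poly (\<lambda>x. f x + g x)"
| scale: "trig_poly f \<Longrightarrow> trig_poly (\<lambda>x. c * f x)"

lemma trig_poly_const: "trig_poly (\<lambda>x. c)"
  using trig_poly.scale[OF trig_poly.wave[of 0 0], of c] by simp

lemma trig_poly_sum:
  "finite S \<Longrightarrow> (\<And>i. i \<in> S \<Longrightarrow> trig_poly (F i)) \<Longrightarrow> trig_poly (\<lambda>x. \<Sum>i\<in>S. F i x)"
  by (induction S rule: finite_induct) (auto intro: trig_poly_const trig_poly.add)

text \<open>The product-to-sum formula handles two waves, and linearity in each factor does the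
  rest. Products are proved here instead of being a rule of \<open>trig_poly\<close> because
  \<open>approximable\<close> is preserved by linear operations only, and the induction in
  \<open>approximable_trig_poly\<close> must go through.\<close>

lemma trig_poly_mult:
  assumes "trig_poly f" "trig_poly g"
  shows "trig_poly (\<lambda>x. f x * g x)"
  using assms(1)
proof induction
  case (wave a s)
  show ?case using assms(2)
  proof induction
    case (wave b t)
    have *: "(\<lambda>x. cos (inner a x + s) * cos (inner b x + t)) =
        (\<lambda>x. 1/2 * cos (inner (a - b) x + (s - t)) + 1/2 * cos (inner (a + b) x + (s + t)))"
      by (simp add: cos_times_cos inner_diff_left inner_add_left algebra_simps add_divide_distrib)
    show ?case unfolding * by (intro trig_poly.intros)
  qed (auto simp: distrib_left mult.left_commute intro: trig_poly.intros)
qed (auto simp: distrib_right mult.assoc intro: trig_poly.intros)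

text \<open>A sine is a wave with phase -pi/2, so a linear form in the sines is a sum of waves; the
  remaining polynomial operations are closure properties.\<close>

lemma trig_poly_polynomial_sin:
  fixes c :: real
  assumes "real_polynomial_function p"
  shows "trig_poly (\<lambda>x::'a::euclidean_space. p (\<Sum>b\<in>Basis. sin (c * inner x b) *\<^sub>R b))"
  using assms
proof induction
  case (linear f)
  have *: "(\<lambda>x::'a. f (\<Sum>b\<in>Basis. sin (c * inner x b) *\<^sub>R b)) =
      (\<lambda>x. \<Sum>b\<in>Basis. f b * cos (inner (c *\<^sub>R b) x + (- (pi / 2))))"
    using linear by (simp add: linear_sum linear_scale bounded_linear.linear inner_commute
        cos_diff mult.commute)
  show ?case unfolding * by (intro trig_poly_sum trig_poly.intros finite_Basis)
qed (auto intro: trig_poly_const trig_poly.intros trig_poly_mult)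

locale wave_space = L2_linear_space M H for M :: "'a::euclidean_space measure" and H +
  assumes sets_M: "sets M = sets borel"
    and approximable_wave: "approximable (\<lambda>x. cos (inner a x + s))"
begin

lemma approximable_trig_poly: "trig_poly f \<Longrightarrow> approximable f"
  by (induction rule: trig_poly.induct)
    (auto intro: approximable_wave approximable_add approximable_scale)

text \<open>The substitution \<open>y\<^sub>b = sin (x\<^sub>b / m)\<close> turns polynomials on the cube into trigonometric
  polynomials that stay close to \<open>f\<close> on a large box and remain bounded on the whole space.\<close>

lemma approximable_continuous:
  assumes cont: "continuous_on UNIV f" and bdd: "\<And>x. \<bar>f x\<bar> \<le> K"
  shows "approximable f"
proof -
  define Y :: "nat \<Rightarrow> 'a \<Rightarrow> 'a" where
    "Y m x = (\<Sum>b\<in>Basis. sin (1 / real (Suc m) * inner x b) *\<^sub>R b)" for m x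
  \<comment> \<open>\<open>X m\<close> inverts \<open>Y m\<close> on a box that grows with
    \<open>m\<close>. The polynomial approximates \<open>f\<close> after \<open>X m\<close> on the
    cube, which contains the whole range of \<open>Y m\<close>.\<close>
  define X :: "nat \<Rightarrow> 'a \<Rightarrow> 'a" where
    "X m y = (\<Sum>b\<in>Basis. (real (Suc m) * arcsin (inner y b)) *\<^sub>R b)" for m y
  let ?C = "cbox (- One) (One :: 'a)"
  have Y_in: "Y m x \<in> ?C" for m x
    by (auto simp: mem_box Y_def)
  have "\<exists>p. real_polynomial_function p \<and> (\<forall>y\<in>?C. \<bar>f (X m y) - p y\<bar> < 1 / real (Suc m))" for m
  proof -
    have "continuous_on ?C (\<lambda>y. f (X m y))"
    proof (rule continuous_on_compose2[OF cont])
      show "continuous_on ?C (X m)"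
        unfolding X_def by (intro continuous_intros) (auto simp: mem_box)
    qed auto
    from Stone_Weierstrass_real_polynomial_function[OF compact_cbox this, of "1 / real (Suc m)"]
    obtain q where "real_polynomial_function q"
      "\<And>y. y \<in> ?C \<Longrightarrow> \<bar>f (X m y) - q y\<bar> < 1 / real (Suc m)"
      by (metis of_nat_0_less_iff zero_less_Suc zero_less_divide_1_iff)
    thus ?thesis by blast
  qed
  then obtain p where p: "\<And>m. real_polynomial_function (p m)"
    and p_close: "\<And>m y. y \<in> ?C \<Longrightarrow> \<bar>f (X m y) - p m y\<bar> < 1 / real (Suc m)"
    by metis
  show ?thesis
  proof (rule approximable_bounded_limit)
    show "approximable (\<lambda>x. p m (Y m x))" for m
      unfolding Y_def by (intro approximable_trig_poly trig_poly_polynomial_sin p)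
    \<comment> \<open>Outside the box \<open>X m (Y m x)\<close> differs from \<open>x\<close>, but
      \<open>f\<close> is still bounded by \<open>K\<close> there: one \<open>K\<close> for each
      value of \<open>f\<close> and 1 for the polynomial error.\<close>
    show "\<bar>p m (Y m x) - f x\<bar> \<le> 2 * K + 1" for m x
    proof -
      have "\<bar>f (X m (Y m x)) - p m (Y m x)\<bar> < 1 / real (Suc m)" using p_close Y_in by blast
      also have "\<dots> \<le> 1" by simp
      finally show ?thesis using bdd[of "X m (Y m x)"] bdd[of x] by linarith
    qed
    show "(\<lambda>m. p m (Y m x)) \<longlonglongrightarrow> f x" for x
    proof -
      have XY: "X m (Y m x) = x" if m: "norm x \<le> real m" for m
      proof (rule euclidean_eqI)
        fix b :: 'a assume b: "b \<in> Basis"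
        have "\<bar>inner x b\<bar> \<le> real (Suc m)" using Basis_le_norm[OF b, of x] m by simp
        \<comment> \<open>Since 1 < pi/2, \<open>arcsin\<close> inverts \<open>sin\<close> at this
          argument.\<close>
        hence "\<bar>1 / real (Suc m) * inner x b\<bar> \<le> 1" by (simp add: abs_mult divide_simps)
        hence "arcsin (sin (1 / real (Suc m) * inner x b)) = 1 / real (Suc m) * inner x b"
          using pi_gt3 by (intro arcsin_sin) linarith+
        thus "inner (X m (Y m x)) b = inner x b" using b by (simp add: X_def Y_def)
      qed
      obtain k where k: "norm x \<le> real k" using real_arch_simple by blast
      have "eventually (\<lambda>m. norm (p m (Y m x) - f x) \<le> 1 / real (Suc m)) sequentially"
        using eventually_ge_at_top[of k]
      proof eventually_elim
        case (elim m)
        thus ?case using p_close[where y="Y m x" and m=m, OF Y_in] XY[of m] k by simp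
      qed
      hence "(\<lambda>m. p m (Y m x) - f x) \<longlonglongrightarrow> 0"
        by (rule Lim_null_comparison) (rule LIMSEQ_inverse_real_of_nat[unfolded inverse_eq_divide])
      thus ?thesis by (simp add: LIM_zero_iff)
    qed
  qed
qed

lemma approximable_indicator_closed:
  assumes "closed S"
  shows "approximable (indicator S)"
\<comment> \<open>The distance to the empty set is 0 by convention, so the functions
  \<open>g m\<close> below would converge to 1 instead of 0.\<close>
proof (cases "S = {}")
  case True
  hence "indicator S = (\<lambda>_. 0 :: real)" by (auto simp: indicator_def)
  thus ?thesis using approximable_continuous[of "\<lambda>_. 0" 0] by simp
next
  case False
  define g where "g m x = max 0 (1 - real m * infdist x S)" for m x
  show ?thesis
  proof (rule approximable_bounded_limit)
    have g: "0 \<le> g m x \<and> g m x \<le> 1" for m x by (auto simp: g_def infdist_nonneg)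
    show "approximable (g m)" for m
    proof (rule approximable_continuous)
      show "\<bar>g m x\<bar> \<le> 1" for x using g[of m x] by simp
    qed (auto simp: g_def intro!: continuous_intros)
    show "\<bar>g m x - indicator S x\<bar> \<le> 1" for m x
      using g[of m x] by (auto simp: indicator_def)
    show "(\<lambda>m. g m x) \<longlonglongrightarrow> indicator S x" for x
    proof (cases "x \<in> S")
      case True
      thus ?thesis by (simp add: g_def)
    next
      case xS: False
      hence d: "infdist x S > 0"
        using in_closed_iff_infdist_zero[OF assms False] infdist_nonneg[of x S] by force
      obtain k where k: "1 / infdist x S \<le> real k" using real_arch_simple by blast
      have "eventually (\<lambda>m. g m x = 0) sequentially"
        using eventually_ge_at_top[of k]
      proof eventually_elim
        case (elim m)
        hence "1 / infdist x S \<le> real m" using k by linarith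
        thus ?case using d by (simp add: g_def divide_simps)
      qed
      thus ?thesis using xS by (simp add: tendsto_eventually)
    qed
  qed
qed

text \<open>Dynkin's argument with the closed sets as intersection-stable generator. For a disjoint
  union the partial sums are again indicators, which keeps the limit bounded.\<close>

lemma approximable_indicator:
  assumes "S \<in> sets M"
  shows "approximable (indicator S)"
proof -
  have "Int_stable (Collect closed :: 'a set set)" "Collect closed \<subseteq> Pow (UNIV :: 'a set)"
    by (auto simp: Int_stable_def)
  moreover have "S \<in> sigma_sets UNIV (Collect closed)"
    using assms by (simp add: sets_M borel_eq_closed)
  ultimately show ?thesis
  proof (induction rule: sigma_sets_induct_disjoint)
    case (basic A)
    thus ?case by (simp add: approximable_indicator_closed)
  next
    case empty
    show ?case by (rule approximable_indicator_closed) simp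
  next
    case (compl A)
    have "approximable (\<lambda>x. 1 + - 1 * indicator A x)"
      by (intro approximable_add approximable_scale compl approximable_trig_poly trig_poly_const)
    moreover have "(\<lambda>x. 1 + - 1 * indicator A x) = (indicator (UNIV - A) :: 'a \<Rightarrow> real)"
      by (auto simp: indicator_def)
    ultimately show ?case by simp
  next
    case (union A)
    show ?case
    proof (rule approximable_bounded_limit)
      show "approximable (\<lambda>x. \<Sum>i<m. indicator (A i) x)" for m :: nat
        using union by (intro approximable_sum) auto
      have eq: "(\<Sum>i<m. indicator (A i) x) = (indicator (\<Union>i<m. A i) x :: real)" for m x
        using union(1) by (subst indicator_UN_disjoint)
          (auto simp: disjoint_family_on_def)
      show "(\<lambda>m. \<Sum>i<m. indicator (A i) x) \<longlonglongrightarrow> (indicator (\<Union>i. A i) x :: real)" for x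
        unfolding eq by (rule LIMSEQ_indicator_UN)
      show "\<bar>(\<Sum>i<m. indicator (A i) x) - indicator (\<Union>i. A i) x\<bar> \<le> (1::real)" for m x
        unfolding eq by (auto simp: indicator_def)
    qed
  qed
qed

lemma approximable_square_integrable:
  "f \<in> borel_measurable M \<Longrightarrow> integrable M (\<lambda>x. (f x)\<^sup>2) \<Longrightarrow> approximable f"
  using approximable_indicator by (rule approximable_L2)

end

section \<open>Monte Carlo error and the law of the parameters\<close>

text \<open>Independence and centring kill the cross term when one summand is added, so the bound
  grows linearly in the number of summands and not quadratically.\<close>

lemma (in prob_space) second_moment_indep_sum_le:
  fixes Y :: "'i \<Rightarrow> 'a \<Rightarrow> real"
  assumes "finite I" "indep_vars (\<lambda>_. borel) Y I"
    and "\<And>i \<omega>. i \<in> I \<Longrightarrow> \<omega> \<in> space M \<Longrightarrow> \<bar>Y i \<omega>\<bar> \<le> L"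
    and "\<And>i. i \<in> I \<Longrightarrow> expectation (Y i) = 0"
  shows "expectation (\<lambda>\<omega>. (\<Sum>i\<in>I. Y i \<omega>)\<^sup>2) \<le> real (card I) * L\<^sup>2"
  using assms
proof (induction I rule: finite_induct)
  case (insert i I)
  let ?S = "\<lambda>\<omega>. \<Sum>i\<in>I. Y i \<omega>"
  have Y[measurable]: "random_variable borel (Y j)" if "j \<in> insert i I" for j
    using insert.prems(1) that by (auto simp: indep_vars_def)
  have [measurable]: "random_variable borel (Y i)" "random_variable borel ?S"
    using Y by auto
  have S_le: "\<bar>?S \<omega>\<bar> \<le> real (card I) * L" if "\<omega> \<in> space M" for \<omega>
    using sum_norm_bound[of I "\<lambda>i. Y i \<omega>" L] insert.prems(2) that by simp
  have sq_le: "y\<^sup>2 \<le> K\<^sup>2" if "\<bar>y\<bar> \<le> K" for y K :: real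
    using that by (metis abs_ge_zero abs_of_nonneg abs_le_square_iff order.trans)
  have int: "integrable M (Y i)" "integrable M ?S"
    using insert.prems(2) S_le by (intro integrable_const_bound[where B=L]
        integrable_const_bound[where B="real (card I) * L"] AE_I2; simp)+
  have ind: "indep_var borel (Y i) borel ?S"
    using insert.hyps insert.prems(1) by (intro indep_vars_sum) auto
  have int2: "integrable M (\<lambda>\<omega>. (Y i \<omega>)\<^sup>2)" "integrable M (\<lambda>\<omega>. (?S \<omega>)\<^sup>2)"
    using insert.prems(2) S_le by (intro integrable_const_bound[where B="L\<^sup>2"]
        integrable_const_bound[where B="(real (card I) * L)\<^sup>2"] AE_I2; simp add: sq_le)+
  have int3: "integrable M (\<lambda>\<omega>. Y i \<omega> * ?S \<omega>)"
    by (rule indep_var_integrable[OF ind int])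
  have "expectation (\<lambda>\<omega>. (\<Sum>i\<in>insert i I. Y i \<omega>)\<^sup>2) =
      expectation (\<lambda>\<omega>. (Y i \<omega>)\<^sup>2 + (?S \<omega>)\<^sup>2 + 2 * (Y i \<omega> * ?S \<omega>))"
    using insert.hyps by (simp add: power2_sum mult.assoc)
  also have "\<dots> = expectation (\<lambda>\<omega>. (Y i \<omega>)\<^sup>2) + expectation (\<lambda>\<omega>. (?S \<omega>)\<^sup>2)
      + 2 * expectation (\<lambda>\<omega>. Y i \<omega> * ?S \<omega>)"
    using int2 int3 by (simp only: Bochner_Integration.integral_add
        Bochner_Integration.integrable_add integrable_mult_right integral_mult_right_zero)
  also have "expectation (\<lambda>\<omega>. Y i \<omega> * ?S \<omega>) = 0"
    using indep_var_lebesgue_integral[OF ind int] insert.prems(3) by simp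
  also have "expectation (\<lambda>\<omega>. (Y i \<omega>)\<^sup>2) \<le> L\<^sup>2"
    using insert.prems(2) by (intro integral_le_const int2 AE_I2) (simp add: sq_le)
  also have "expectation (\<lambda>\<omega>. (?S \<omega>)\<^sup>2) \<le> real (card I) * L\<^sup>2"
    using insert.prems by (intro insert.IH) (auto intro: indep_vars_subset)
  finally show ?case using insert.hyps by (simp add: algebra_simps)
qed simp

lemma (in prob_space) mean_square_error_sample_mean_le:
  fixes X :: "'i \<Rightarrow> 'a \<Rightarrow> real"
  assumes "finite I" "I \<noteq> {}" and ind: "indep_vars (\<lambda>_. borel) X I"
    and X: "\<And>i \<omega>. i \<in> I \<Longrightarrow> \<omega> \<in> space M \<Longrightarrow> \<bar>X i \<omega>\<bar> \<le> K"
    and m: "\<And>i. i \<in> I \<Longrightarrow> expectation (X i) = m"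
  shows "(\<integral>\<^sup>+\<omega>. ennreal (((\<Sum>i\<in>I. X i \<omega>) / real (card I) - m)\<^sup>2) \<partial>M) \<le> ennreal ((2 * K)\<^sup>2 / real (card I))"
proof -
  let ?n = "real (card I)"
  have n: "?n > 0" using assms(1,2) by (simp add: card_gt_0_iff)
  have [measurable]: "i \<in> I \<Longrightarrow> random_variable borel (X i)" for i
    using ind by (simp add: indep_vars_def)
  have int: "integrable M (X i)" if "i \<in> I" for i
    using X that by (intro integrable_const_bound[where B=K] AE_I2) auto
  obtain i where i: "i \<in> I" using assms(2) by blast
  \<comment> \<open>The mean inherits the bound \<open>K\<close>, so the centred variables are
    bounded by \<open>2 * K\<close>, the constant in the conclusion.\<close>
  have m_le: "\<bar>m\<bar> \<le> K"
  proof -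
    have "expectation (X i) \<le> K" "- K \<le> expectation (X i)"
      using X[OF i] by (auto intro!: integral_le_const integral_ge_const int[OF i] AE_I2
          simp: abs_le_iff minus_le_iff)
    thus ?thesis using m[OF i] by simp
  qed
  have Y_le: "\<bar>X i \<omega> - m\<bar> \<le> 2 * K" if "i \<in> I" "\<omega> \<in> space M" for i \<omega>
    using X[OF that] m_le by linarith
  have eq: "((\<Sum>i\<in>I. X i \<omega>) / ?n - m)\<^sup>2 = (\<Sum>i\<in>I. X i \<omega> - m)\<^sup>2 / ?n\<^sup>2" for \<omega>
    using n by (simp add: sum_subtractf power_divide[symmetric] diff_divide_distrib)
  have bnd: "\<bar>(\<Sum>i\<in>I. X i \<omega> - m)\<bar> \<le> ?n * (2 * K)" if "\<omega> \<in> space M" for \<omega>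
    using sum_norm_bound[of I "\<lambda>i. X i \<omega> - m" "2 * K"] Y_le that by simp
  have "integrable M (\<lambda>\<omega>. (\<Sum>i\<in>I. X i \<omega> - m)\<^sup>2)"
  proof (rule integrable_const_bound[where B="(?n * (2 * K))\<^sup>2"])
    show "AE \<omega> in M. norm ((\<Sum>i\<in>I. X i \<omega> - m)\<^sup>2) \<le> (?n * (2 * K))\<^sup>2"
    proof (rule AE_I2)
      fix \<omega> assume "\<omega> \<in> space M"
      hence "\<bar>(\<Sum>i\<in>I. X i \<omega> - m)\<bar>\<^sup>2 \<le> (?n * (2 * K))\<^sup>2" by (intro power_mono bnd) auto
      thus "norm ((\<Sum>i\<in>I. X i \<omega> - m)\<^sup>2) \<le> (?n * (2 * K))\<^sup>2" by simp
    qed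
  qed measurable
  hence "(\<integral>\<^sup>+\<omega>. ennreal (((\<Sum>i\<in>I. X i \<omega>) / ?n - m)\<^sup>2) \<partial>M) =
      ennreal (expectation (\<lambda>\<omega>. (\<Sum>i\<in>I. X i \<omega> - m)\<^sup>2 / ?n\<^sup>2))"
    unfolding eq by (intro nn_integral_eq_integral) auto
  also have "expectation (\<lambda>\<omega>. (\<Sum>i\<in>I. X i \<omega> - m)\<^sup>2 / ?n\<^sup>2) =
      expectation (\<lambda>\<omega>. (\<Sum>i\<in>I. X i \<omega> - m)\<^sup>2) / ?n\<^sup>2"
    by simp
  also have "\<dots> \<le> (?n * (2 * K)\<^sup>2) / ?n\<^sup>2"
  proof (intro divide_right_mono second_moment_indep_sum_le)
    show "indep_vars (\<lambda>_. borel) (\<lambda>i \<omega>. X i \<omega> - m) I"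
      by (rule indep_vars_compose2[OF ind]) simp
    show "expectation (\<lambda>\<omega>. X i \<omega> - m) = 0" if "i \<in> I" for i
      using int[OF that] m[OF that] by (simp add: prob_space)
  qed (use assms(1) Y_le in auto)
  also have "\<dots> = (2 * K)\<^sup>2 / ?n"
    by (simp add: power2_eq_square)
  finally show ?thesis by (simp add: ennreal_leI)
qed

section \<open>The joint law and independence of the parameter pairs\<close>

definition fair_coin :: "real measure" where
  "fair_coin = distr (measure_pmf (pmf_of_set {0, 1})) borel (\<lambda>b. b)"

lemma prob_space_fair_coin: "prob_space fair_coin"
  unfolding fair_coin_def by (intro prob_space.prob_space_distr prob_space_measure_pmf) simp

lemma sets_fair_coin [measurable_cong]: "sets fair_coin = sets borel"
  by (simp add: fair_coin_def)

lemma emeasure_fair_coin: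
  assumes "T \<in> sets borel"
  shows "emeasure fair_coin T = ennreal ((indicator T 0 + indicator T 1) / 2)"
proof -
  have "{0, 1} \<inter> T = (if 0 \<in> T then {0} else {}) \<union> (if 1 \<in> T then {1} else {})" by auto
  thus ?thesis
    using assms by (simp add: fair_coin_def emeasure_distr emeasure_pmf_of_set indicator_def)
qed

lemma (in prob_space) distr_eq_fair_coin:
  assumes [measurable]: "random_variable borel B"
    and B0: "prob {\<omega>\<in>space M. B \<omega> = 0} = 1/2" and B1: "prob {\<omega>\<in>space M. B \<omega> = 1} = 1/2"
  shows "distr M borel B = fair_coin"
proof (rule measure_eqI)
  fix T assume "T \<in> sets (distr M borel B)"
  hence T[measurable]: "T \<in> sets borel" by simp
  \<comment> \<open>The two point masses already exhaust the probability, so \<open>B\<close> takes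
    no other value almost surely and they determine its law.\<close>
  have "prob ({\<omega>\<in>space M. B \<omega> = 0} \<union> {\<omega>\<in>space M. B \<omega> = 1}) = 1"
    using B0 B1 by (subst finite_measure_Union) auto
  hence AE: "AE \<omega> in M. B \<omega> = 0 \<or> B \<omega> = 1"
    by (subst (asm) prob_eq_1) auto
  have "prob (B -` T \<inter> space M) =
      prob ({\<omega>\<in>space M. B \<omega> = 0 \<and> 0 \<in> T} \<union> {\<omega>\<in>space M. B \<omega> = 1 \<and> 1 \<in> T})"
    using AE by (intro measure_eq_AE) auto
  also have "\<dots> = prob {\<omega>\<in>space M. B \<omega> = 0 \<and> 0 \<in> T} + prob {\<omega>\<in>space M. B \<omega> = 1 \<and> 1 \<in> T}"
    by (intro finite_measure_Union) auto
  also have "\<dots> = (indicator T 0 + indicator T 1) / 2"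
    using B0 B1 by (simp add: indicator_def)
  finally show "emeasure (distr M borel B) T = emeasure fair_coin T"
    by (simp add: emeasure_distr emeasure_fair_coin emeasure_eq_measure)
qed (simp add: sets_fair_coin)

text \<open>Places events about a single variable in the sigma-algebra generated by the whole
  family, where the independence of the two families is formulated.\<close>

lemma measurable_vimage_algebra_restrict:
  assumes "i \<in> I"
  shows "X i \<in> vimage_algebra S (\<lambda>\<omega>. \<lambda>i\<in>I. X i \<omega>) (PiM I (\<lambda>_. borel)) \<rightarrow>\<^sub>M borel"
proof -
  have "(\<lambda>\<omega>. (\<lambda>i\<in>I. X i \<omega>) i) \<in> vimage_algebra S (\<lambda>\<omega>. \<lambda>i\<in>I. X i \<omega>) (PiM I (\<lambda>_. borel)) \<rightarrow>\<^sub>M borel"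
    using assms by (intro measurable_compose[OF measurable_vimage_algebra1 measurable_component_singleton])
      (auto simp: space_PiM)
  thus ?thesis using assms by simp
qed

locale qrnn_parameter_family = prob_space M for M :: "'w measure" +
  fixes p :: "real^'d \<Rightarrow> real" and n :: nat
    and A :: "nat \<Rightarrow> 'w \<Rightarrow> real^'d" and B :: "nat \<Rightarrow> 'w \<Rightarrow> real"
  assumes params: "qrnn_parameters M p n A B" and n_pos: "n \<ge> 1"
begin

lemma measurable_A: "i \<in> {1..n} \<Longrightarrow> random_variable borel (A i)"
  and measurable_B: "i \<in> {1..n} \<Longrightarrow> random_variable borel (B i)"
  using params by (auto simp: qrnn_parameters_def indep_vars_def)

text \<open>The probability factorises in two stages: between the families by
  \<open>indep_set\<close>, then within each family by \<open>indep_vars\<close>. A singleton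
  \<open>J\<close> gives the law of one pair, and the full index set gives the independence of the
  pairs.\<close>

lemma prob_INT_A_B:
  assumes J: "J \<subseteq> {1..n}" "J \<noteq> {}"
    and S: "\<And>i. i \<in> J \<Longrightarrow> S i \<in> sets borel" and T: "\<And>i. i \<in> J \<Longrightarrow> T i \<in> sets borel"
  shows "prob (\<Inter>i\<in>J. (\<lambda>\<omega>. (A i \<omega>, B i \<omega>)) -` (S i \<times> T i) \<inter> space M) =
    (\<Prod>i\<in>J. prob (A i -` S i \<inter> space M) * prob (B i -` T i \<inter> space M))"
proof -
  have fin: "finite J" using J(1) finite_subset by blast
  let ?VA = "vimage_algebra (space M) (\<lambda>\<omega>. \<lambda>i\<in>{1..n}. A i \<omega>) (PiM {1..n} (\<lambda>_. borel))"
  let ?VB = "vimage_algebra (space M) (\<lambda>\<omega>. \<lambda>i\<in>{1..n}. B i \<omega>) (PiM {1..n} (\<lambda>_. borel))"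
  have "(\<Inter>i\<in>J. A i -` S i \<inter> space M) \<in> sets ?VA"
  proof (rule sets.finite_INT[OF fin J(2)])
    fix i assume "i \<in> J"
    thus "A i -` S i \<inter> space M \<in> sets ?VA"
      using measurable_sets[OF measurable_vimage_algebra_restrict[of i "{1..n}" A] S, of i] J(1)
      by auto
  qed
  moreover have "(\<Inter>i\<in>J. B i -` T i \<inter> space M) \<in> sets ?VB"
  proof (rule sets.finite_INT[OF fin J(2)])
    fix i assume "i \<in> J"
    thus "B i -` T i \<inter> space M \<in> sets ?VB"
      using measurable_sets[OF measurable_vimage_algebra_restrict[of i "{1..n}" B] T, of i] J(1)
      by auto
  qed
  moreover have "indep_set (sets ?VA) (sets ?VB)"
    using params by (simp add: qrnn_parameters_def)
  ultimately have "prob ((\<Inter>i\<in>J. A i -` S i \<inter> space M) \<inter> (\<Inter>i\<in>J. B i -` T i \<inter> space M)) =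
      prob (\<Inter>i\<in>J. A i -` S i \<inter> space M) * prob (\<Inter>i\<in>J. B i -` T i \<inter> space M)"
    by (intro indep_setD)
  also have "(\<Inter>i\<in>J. A i -` S i \<inter> space M) \<inter> (\<Inter>i\<in>J. B i -` T i \<inter> space M) =
      (\<Inter>i\<in>J. (\<lambda>\<omega>. (A i \<omega>, B i \<omega>)) -` (S i \<times> T i) \<inter> space M)"
    by auto
  also have "prob (\<Inter>i\<in>J. A i -` S i \<inter> space M) = (\<Prod>i\<in>J. prob (A i -` S i \<inter> space M))"
    using params J fin S by (intro indep_varsD[of "\<lambda>_. borel"]) (auto simp: qrnn_parameters_def)
  also have "prob (\<Inter>i\<in>J. B i -` T i \<inter> space M) = (\<Prod>i\<in>J. prob (B i -` T i \<inter> space M))"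
    using params J fin T by (intro indep_varsD[of "\<lambda>_. borel"]) (auto simp: qrnn_parameters_def)
  finally show ?thesis by (simp add: prod.distrib)
qed

lemma prob_A_B:
  assumes "i \<in> {1..n}" "S \<in> sets borel" "T \<in> sets borel"
  shows "prob ((\<lambda>\<omega>. (A i \<omega>, B i \<omega>)) -` (S \<times> T) \<inter> space M) =
    prob (A i -` S \<inter> space M) * prob (B i -` T \<inter> space M)"
  using prob_INT_A_B[of "{i}" "\<lambda>_. S" "\<lambda>_. T"] assms by simp

lemma measurable_pair:
  "i \<in> {1..n} \<Longrightarrow> random_variable (borel \<Otimes>\<^sub>M borel) (\<lambda>\<omega>. (A i \<omega>, B i \<omega>))"
  using measurable_A measurable_B by simp

lemma indep_vars_pairs:
  "indep_vars (\<lambda>_. borel \<Otimes>\<^sub>M borel) (\<lambda>i \<omega>. (A i \<omega>, B i \<omega>)) {1..n}"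
proof -
  let ?E = "{S \<times> T | S T. S \<in> sets (borel :: (real^'d) measure) \<and> T \<in> sets (borel :: real measure)}"
  have "indep_vars (\<lambda>_. borel \<Otimes>\<^sub>M borel) (\<lambda>i \<omega>. (A i \<omega>, B i \<omega>)) {1..n} \<longleftrightarrow>
    (\<forall>R\<in>(\<Pi> i\<in>{1..n}. ?E). prob (\<Inter>j\<in>{1..n}. (\<lambda>\<omega>. (A j \<omega>, B j \<omega>)) -` R j \<inter> space M) =
      (\<Prod>j\<in>{1..n}. prob ((\<lambda>\<omega>. (A j \<omega>, B j \<omega>)) -` R j \<inter> space M)))"
  proof (rule indep_vars_finite)
    show "sets (borel \<Otimes>\<^sub>M borel) = sigma_sets (space ((borel :: (real^'d) measure) \<Otimes>\<^sub>M (borel :: real measure))) ?E"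
      by (simp add: sets_pair_measure space_pair_measure)
    show "Int_stable ?E" by (rule Int_stable_pair_measure_generator)
    show "space ((borel :: (real^'d) measure) \<Otimes>\<^sub>M (borel :: real measure)) \<in> ?E"
      by (auto simp: space_pair_measure intro!: exI[of _ UNIV])
  qed (use n_pos measurable_pair in \<open>auto simp: space_pair_measure\<close>)
  moreover have "prob (\<Inter>j\<in>{1..n}. (\<lambda>\<omega>. (A j \<omega>, B j \<omega>)) -` R j \<inter> space M) =
      (\<Prod>j\<in>{1..n}. prob ((\<lambda>\<omega>. (A j \<omega>, B j \<omega>)) -` R j \<inter> space M))"
    if R: "R \<in> (\<Pi> i\<in>{1..n}. ?E)" for R
  proof -
    have "\<forall>i\<in>{1..n}. \<exists>S T. R i = S \<times> T \<and> S \<in> sets borel \<and> T \<in> sets borel"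
      using R by (auto simp: Pi_iff)
    then obtain S T where ST: "\<And>i. i \<in> {1..n} \<Longrightarrow> R i = S i \<times> T i"
        "\<And>i. i \<in> {1..n} \<Longrightarrow> S i \<in> sets borel" "\<And>i. i \<in> {1..n} \<Longrightarrow> T i \<in> sets borel"
      by metis
    have "prob (\<Inter>j\<in>{1..n}. (\<lambda>\<omega>. (A j \<omega>, B j \<omega>)) -` R j \<inter> space M) =
        prob (\<Inter>j\<in>{1..n}. (\<lambda>\<omega>. (A j \<omega>, B j \<omega>)) -` (S j \<times> T j) \<inter> space M)"
      using ST(1) by (intro arg_cong[where f=prob] INF_cong) auto
    also have "\<dots> = (\<Prod>j\<in>{1..n}. prob (A j -` S j \<inter> space M) * prob (B j -` T j \<inter> space M))"
      using n_pos ST(2,3) by (intro prob_INT_A_B) auto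
    also have "\<dots> = (\<Prod>j\<in>{1..n}. prob ((\<lambda>\<omega>. (A j \<omega>, B j \<omega>)) -` R j \<inter> space M))"
      using ST by (intro prod.cong refl) (simp only: prob_A_B)
    finally show ?thesis .
  qed
  ultimately show ?thesis by blast
qed

lemma distr_pair:
  assumes i: "i \<in> {1..n}"
  shows "distr M (borel \<Otimes>\<^sub>M borel) (\<lambda>\<omega>. (A i \<omega>, B i \<omega>)) =
    density lborel (\<lambda>\<xi>. ennreal (p \<xi>)) \<Otimes>\<^sub>M fair_coin"
proof -
  have [measurable]: "random_variable borel (A i)" "random_variable borel (B i)"
    using measurable_A[OF i] measurable_B[OF i] by auto
  have "distributed M lborel (A i) (\<lambda>\<xi>. ennreal (p \<xi>))"
    using params i by (simp add: qrnn_parameters_def)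
  hence A_law: "distr M borel (A i) = density lborel (\<lambda>\<xi>. ennreal (p \<xi>))"
    using distributed_distr_eq_density by (metis distr_cong sets_lborel)
  have B_law: "distr M borel (B i) = fair_coin"
    using params i by (intro distr_eq_fair_coin) (auto simp: qrnn_parameters_def)
  interpret A: prob_space "distr M borel (A i)" by (rule prob_space_distr) simp
  interpret B: prob_space "distr M borel (B i)" by (rule prob_space_distr) simp
  have "distr M borel (A i) \<Otimes>\<^sub>M distr M borel (B i) =
      distr M (borel \<Otimes>\<^sub>M borel) (\<lambda>\<omega>. (A i \<omega>, B i \<omega>))"
  proof (rule pair_measure_eqI)
    fix S T assume "S \<in> sets (distr M borel (A i))" "T \<in> sets (distr M borel (B i))"
    hence [measurable]: "S \<in> sets borel" "T \<in> sets borel" by simp_all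
    show "emeasure (distr M borel (A i)) S * emeasure (distr M borel (B i)) T =
        emeasure (distr M (borel \<Otimes>\<^sub>M borel) (\<lambda>\<omega>. (A i \<omega>, B i \<omega>))) (S \<times> T)"
      using prob_A_B[OF i, of S T]
      by (simp add: emeasure_distr emeasure_eq_measure ennreal_mult[symmetric])
  next
    show "sets (distr M borel (A i) \<Otimes>\<^sub>M distr M borel (B i)) =
        sets (distr M (borel \<Otimes>\<^sub>M borel) (\<lambda>\<omega>. (A i \<omega>, B i \<omega>)))"
      by (simp cong: sets_pair_measure_cong)
  qed unfold_locales
  thus ?thesis by (simp add: A_law B_law)
qed

end

section \<open>Random cosine features\<close>

definition feature :: "'a::real_inner \<times> real \<Rightarrow> 'a \<Rightarrow> real" where
  "feature z x = cos (2 * pi * inner (fst z) x + pi / 2 * snd z)"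

lemma feature_measurable [measurable]:
  fixes g :: "'b \<Rightarrow> 'a::euclidean_space"
  assumes "f \<in> M \<rightarrow>\<^sub>M borel \<Otimes>\<^sub>M borel" "g \<in> borel_measurable M"
  shows "(\<lambda>w. feature (f w) (g w)) \<in> borel_measurable M"
  using assms unfolding feature_def by measurable

lemma abs_feature_le_1: "\<bar>feature z x\<bar> \<le> 1"
  by (simp add: feature_def)

lemma abs_cos_diff_le: "\<bar>cos u - cos v\<bar> \<le> \<bar>u - v\<bar>" for u v :: real
proof -
  have "\<bar>cos u - cos v\<bar> = 2 * (\<bar>sin ((u + v) / 2)\<bar> * \<bar>sin ((v - u) / 2)\<bar>)"
    by (simp add: cos_diff_cos abs_mult)
  also have "\<dots> \<le> 2 * (1 * \<bar>(v - u) / 2\<bar>)"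
    by (intro mult_left_mono mult_mono abs_sin_x_le_abs_x) auto
  finally show ?thesis by simp
qed

lemma abs_feature_diff_le:
  "\<bar>feature (a', b) x - feature (a, b) x\<bar> \<le> 2 * pi * (norm (a' - a) * norm x)"
proof -
  have "\<bar>feature (a', b) x - feature (a, b) x\<bar> \<le> \<bar>2 * pi * inner (a' - a) x\<bar>"
    unfolding feature_def
    by (rule order.trans[OF abs_cos_diff_le]) (simp add: inner_diff_left algebra_simps)
  also have "\<dots> \<le> 2 * pi * (norm (a' - a) * norm x)"
    by (simp add: abs_mult Cauchy_Schwarz_ineq2)
  finally show ?thesis .
qed

text \<open>The functions of which a network with weights \<open>G\<close> is an unbiased estimate.
  Boundedness of \<open>G\<close> is what controls the variance.\<close>

definition feature_means :: "('a::euclidean_space \<times> real) measure \<Rightarrow> ('a \<Rightarrow> real) set" where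
  "feature_means \<nu> =
     {(\<lambda>x. \<integral>z. G z * feature z x \<partial>\<nu>) | G. G \<in> borel_measurable \<nu> \<and> (\<exists>K. \<forall>z. \<bar>G z\<bar> \<le> K)}"

text \<open>\<open>w\<close> is a probability density with respect to \<open>M\<close>, so the
  average of \<open>u\<close> is off by no more than \<open>u\<close> is where \<open>w\<close> is
  nonzero. It serves to localise the parameters near a chosen point.\<close>

lemma (in prob_space) abs_weighted_mean_diff_le:
  fixes w u :: "'a \<Rightarrow> real"
  assumes w: "integrable M w" "\<And>z. 0 \<le> w z" "(\<integral>z. w z \<partial>M) = 1"
    and int: "integrable M (\<lambda>z. w z * u z)"
    and le: "\<And>z. z \<in> space M \<Longrightarrow> w z \<noteq> 0 \<Longrightarrow> \<bar>u z - c\<bar> \<le> t"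
  shows "\<bar>(\<integral>z. w z * u z \<partial>M) - c\<bar> \<le> t"
proof -
  have "(\<integral>z. w z * u z \<partial>M) - c = (\<integral>z. w z * u z \<partial>M) - (\<integral>z. w z * c \<partial>M)"
    using w by simp
  also have "\<dots> = (\<integral>z. w z * u z - w z * c \<partial>M)"
    using w int by (simp add: Bochner_Integration.integral_diff)
  finally have "\<bar>(\<integral>z. w z * u z \<partial>M) - c\<bar> \<le> (\<integral>z. \<bar>w z * u z - w z * c\<bar> \<partial>M)"
    by (simp only: integral_abs_bound)
  also have "\<dots> \<le> (\<integral>z. w z * t \<partial>M)"
  proof (rule integral_mono)
    fix z assume z: "z \<in> space M"
    have "\<bar>w z * u z - w z * c\<bar> = w z * \<bar>u z - c\<bar>"
      using w(2)[of z] by (simp add: right_diff_distrib[symmetric] abs_mult)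
    also have "\<dots> \<le> w z * t"
      using le[OF z] w(2)[of z] by (cases "w z = 0") (auto intro: mult_left_mono)
    finally show "\<bar>w z * u z - w z * c\<bar> \<le> w z * t" .
  qed (use w int in auto)
  also have "\<dots> = t" using w by simp
  finally show ?thesis .
qed

locale feature_law = \<mu>: prob_space \<mu> + \<nu>: prob_space \<nu>
  for \<mu> :: "'a::euclidean_space measure" and \<nu> :: "('a \<times> real) measure" +
  assumes sets_\<mu> [measurable_cong]: "sets \<mu> = sets borel"
    and sets_\<nu> [measurable_cong]: "sets \<nu> = sets (borel \<Otimes>\<^sub>M borel)"
    and pos: "\<And>a b r. b \<in> {0, 1} \<Longrightarrow> r > 0 \<Longrightarrow> measure \<nu> (ball a r \<times> {b}) > 0"
begin

lemma integrable_weighted_feature: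
  assumes [measurable]: "G \<in> borel_measurable \<nu>" and K: "\<And>z. \<bar>G z\<bar> \<le> K"
  shows "integrable \<nu> (\<lambda>z. G z * feature z x)"
proof (rule \<nu>.integrable_const_bound)
  show "AE z in \<nu>. norm (G z * feature z x) \<le> K"
  proof (rule AE_I2)
    fix z
    have "\<bar>G z\<bar> * \<bar>feature z x\<bar> \<le> K * 1"
      using K[of z] abs_feature_le_1[of z x] by (intro mult_mono) auto
    thus "norm (G z * feature z x) \<le> K" by (simp add: abs_mult)
  qed
qed measurable

sublocale L2_linear_space \<mu> "feature_means \<nu>"
proof
  fix h assume "h \<in> feature_means \<nu>"
  then obtain G where [measurable]: "G \<in> borel_measurable \<nu>"
      and h: "h = (\<lambda>x. \<integral>z. G z * feature z x \<partial>\<nu>)"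
    by (auto simp: feature_means_def)
  show "h \<in> borel_measurable \<mu>" unfolding h by measurable
next
  fix g h assume "g \<in> feature_means \<nu>" "h \<in> feature_means \<nu>"
  then obtain G K H L where G: "G \<in> borel_measurable \<nu>" "\<And>z. \<bar>G z\<bar> \<le> K"
      and g: "g = (\<lambda>x. \<integral>z. G z * feature z x \<partial>\<nu>)"
      and H: "H \<in> borel_measurable \<nu>" "\<And>z. \<bar>H z\<bar> \<le> L"
      and h: "h = (\<lambda>x. \<integral>z. H z * feature z x \<partial>\<nu>)"
    by (auto simp: feature_means_def)
  have "\<bar>G z + H z\<bar> \<le> K + L" for z using G(2)[of z] H(2)[of z] by linarith
  moreover have "(\<lambda>x. g x + h x) = (\<lambda>x. \<integral>z. (G z + H z) * feature z x \<partial>\<nu>)"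
    using integrable_weighted_feature[OF G] integrable_weighted_feature[OF H]
    by (simp add: g h distrib_right)
  ultimately show "(\<lambda>x. g x + h x) \<in> feature_means \<nu>"
    unfolding feature_means_def using G(1) H(1)
    by (intro CollectI exI[of _ "\<lambda>z. G z + H z"]) auto
next
  fix c h assume "h \<in> feature_means \<nu>"
  then obtain G K where G: "G \<in> borel_measurable \<nu>" "\<And>z. \<bar>G z\<bar> \<le> K"
      and h: "h = (\<lambda>x. \<integral>z. G z * feature z x \<partial>\<nu>)"
    by (auto simp: feature_means_def)
  have "\<bar>c * G z\<bar> \<le> \<bar>c\<bar> * K" for z using G(2)[of z] by (simp add: abs_mult mult_left_mono)
  moreover have "(\<lambda>x. c * h x) = (\<lambda>x. \<integral>z. (c * G z) * feature z x \<partial>\<nu>)"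
    by (simp add: h mult.assoc)
  ultimately show "(\<lambda>x. c * h x) \<in> feature_means \<nu>"
    unfolding feature_means_def using G(1)
    by (intro CollectI exI[of _ "\<lambda>z. c * G z"]) auto
qed

lemma approximable_feature:
  assumes b: "b \<in> {0, 1}"
  shows "approximable (feature (a, b))"
proof -
  define R where "R m = ball a (1 / real (Suc m)) \<times> {b}" for m
  define G where "G m z = indicator (R m) z / measure \<nu> (R m)" for m z
  have [measurable]: "R m \<in> sets (borel \<Otimes>\<^sub>M borel)" for m
    unfolding R_def by measurable
  have R_pos: "measure \<nu> (R m) > 0" for m
    unfolding R_def by (intro pos b) simp
  have G: "G m \<in> borel_measurable \<nu>" for m
    unfolding G_def by measurable
  have G_nonneg: "0 \<le> G m z" for m z by (simp add: G_def)
  have G_le: "\<bar>G m z\<bar> \<le> 1 / measure \<nu> (R m)" for m z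
    by (simp add: G_def indicator_def)
  have G_int: "integrable \<nu> (G m)" for m
    using G G_le[of m] by (intro \<nu>.integrable_const_bound[where B="1 / measure \<nu> (R m)"]) auto
  have G_1: "(\<integral>z. G m z \<partial>\<nu>) = 1" for m
    using R_pos[of m] by (simp add: G_def sets_\<nu>)
  note weighted = \<nu>.abs_weighted_mean_diff_le[OF G_int G_nonneg G_1 integrable_weighted_feature[OF G G_le]]
  show ?thesis
  proof (rule approximable_bounded_limit)
    show "approximable (\<lambda>x. \<integral>z. G m z * feature z x \<partial>\<nu>)" for m
      unfolding feature_means_def using G[of m] G_le[of m]
      by (intro approximable_base[unfolded feature_means_def] CollectI exI[of _ "G m"] conjI) auto
    show "\<bar>(\<integral>z. G m z * feature z x \<partial>\<nu>) - feature (a, b) x\<bar> \<le> 2" for m x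
    proof (rule weighted)
      fix z show "\<bar>feature z x - feature (a, b) x\<bar> \<le> 2"
        using abs_feature_le_1[of z x] abs_feature_le_1[of "(a, b)" x] by linarith
    qed
    show "(\<lambda>m. \<integral>z. G m z * feature z x \<partial>\<nu>) \<longlonglongrightarrow> feature (a, b) x" for x
    proof -
      \<comment> \<open>The rate deteriorates with the norm of \<open>x\<close>, so only pointwise
        convergence results; the uniform bound 2 shown before turns it into convergence in mean
        square. The coin value is held fixed, and only the frequency is perturbed.\<close>
      have le: "\<bar>(\<integral>z. G m z * feature z x \<partial>\<nu>) - feature (a, b) x\<bar> \<le>
          2 * pi * norm x * inverse (real (Suc m))" for m
      proof (rule weighted)
        fix z assume "G m z \<noteq> 0"
        hence z: "snd z = b" "norm (fst z - a) \<le> 1 / real (Suc m)"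
          by (auto simp: G_def R_def indicator_def dist_norm norm_minus_commute split: if_splits)
        have "\<bar>feature z x - feature (a, b) x\<bar> \<le> 2 * pi * (norm (fst z - a) * norm x)"
          using abs_feature_diff_le[of "fst z" b x a] z(1) by (metis prod.collapse)
        also have "\<dots> \<le> 2 * pi * (1 / real (Suc m) * norm x)"
          using z(2) by (intro mult_left_mono mult_right_mono) auto
        finally show "\<bar>feature z x - feature (a, b) x\<bar> \<le> 2 * pi * norm x * inverse (real (Suc m))"
          by (simp add: field_simps)
      qed
      have "(\<lambda>m. (\<integral>z. G m z * feature z x \<partial>\<nu>) - feature (a, b) x) \<longlonglongrightarrow> 0"
      proof (rule Lim_null_comparison)
        show "eventually (\<lambda>m. norm ((\<integral>z. G m z * feature z x \<partial>\<nu>) - feature (a, b) x) \<le>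
            2 * pi * norm x * inverse (real (Suc m))) sequentially"
          unfolding real_norm_def using le by (intro always_eventually allI)
        show "(\<lambda>m. 2 * pi * norm x * inverse (real (Suc m))) \<longlonglongrightarrow> 0"
          by (rule tendsto_mult_right_zero[OF LIMSEQ_inverse_real_of_nat])
      qed
      thus ?thesis by (simp add: LIM_zero_iff)
    qed
  qed
qed

sublocale wave_space \<mu> "feature_means \<nu>"
proof
  show "sets \<mu> = sets borel" by (rule sets_\<mu>)
  fix a :: 'a and s :: real
  let ?a = "a /\<^sub>R (2 * pi)"
  \<comment> \<open>Rescaling the frequency cancels the factor 2 pi. The coin value 1 gives -sin,
    hence the plus sign in front of \<open>sin s\<close> in the addition theorem for the
    cosine.\<close>
  have "approximable (\<lambda>x. cos s * feature (?a, 0) x + sin s * feature (?a, 1) x)"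
    by (intro approximable_add approximable_scale approximable_feature) auto
  moreover have "(\<lambda>x. cos s * feature (?a, 0) x + sin s * feature (?a, 1) x) =
      (\<lambda>x. cos (inner a x + s))"
  proof -
    have "2 * pi * inner ?a x = inner a x" for x by simp
    thus ?thesis by (simp only: feature_def fst_conv snd_conv) (simp add: cos_add algebra_simps)
  qed
  ultimately show "approximable (\<lambda>x. cos (inner a x + s))" by simp
qed

end

section \<open>Bias-variance estimate and choice of the network size\<close>

theorem mainTheorem4:
  fixes \<mu> :: "(real^'d::{finite,linorder}) measure"
    and f \<pi>\<^sub>a :: "real^'d::_ \<Rightarrow> real"
    and M :: "'w measure"
    and A :: "nat \<Rightarrow> nat \<Rightarrow> 'w \<Rightarrow> real^'d::_"
    and B :: "nat \<Rightarrow> nat \<Rightarrow> 'w \<Rightarrow> real"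
    and V :: "nat \<Rightarrow> complex mat"
    and \<epsilon> :: real
  assumes "prob_space \<mu>" and "sets \<mu> = sets borel"
    and "f \<in> borel_measurable \<mu>" and "integrable \<mu> (\<lambda>x. (f x)\<^sup>2)"
    and "prob_space (density lborel (\<lambda>\<xi>. ennreal (\<pi>\<^sub>a \<xi>)))"
    and "continuous_on UNIV \<pi>\<^sub>a" and "\<And>\<xi>. \<pi>\<^sub>a \<xi> > 0"
    and "decays_at_most_polynomially \<pi>\<^sub>a"
    and "prob_space M"
    and "\<And>n. n \<ge> 1 \<Longrightarrow> qrnn_parameters M \<pi>\<^sub>a n (A n) (B n)"
    and "\<And>n. n \<ge> 1 \<Longrightarrow> state_preparation n (V n)"
    and "\<epsilon> > 0"
  shows "\<exists>n\<ge>1. \<exists>W \<in> sigma_AB M n (A n) (B n) \<rightarrow>\<^sub>M PiM {..<n} (\<lambda>_. borel).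
    (let E = \<integral>\<^sup>+\<omega>. (\<integral>\<^sup>+x. ennreal (\<bar>qrnn n (V n) (\<lambda>i. A n i \<omega>) (\<lambda>i. B n i \<omega>) (W \<omega>) x - f x\<bar>\<^sup>2) \<partial>\<mu>) \<partial>M
     in E < \<infinity> \<and> sqrt (enn2real E) \<le> \<epsilon>)"
proof -
  interpret \<mu>: prob_space \<mu> by fact
  interpret M: prob_space M by fact
  define D where "D = density lborel (\<lambda>\<xi>. ennreal (\<pi>\<^sub>a \<xi>))"
  interpret D: prob_space D unfolding D_def by fact
  interpret C: prob_space fair_coin by (rule prob_space_fair_coin)
  interpret DC: pair_prob_space D fair_coin ..
  have sets_D [measurable_cong]: "sets D = sets borel" by (simp add: D_def)
  have \<pi>_meas [measurable]: "\<pi>\<^sub>a \<in> borel_measurable borel"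
    using assms(6) by (rule borel_measurable_continuous_onI)
  have \<pi>_pos: "ennreal (\<pi>\<^sub>a \<xi>) \<noteq> 0" for \<xi>
    using assms(7)[of \<xi>] by (simp add: ennreal_eq_0_iff not_le)
  interpret feature_law \<mu> "D \<Otimes>\<^sub>M fair_coin"
  proof
    show "sets \<mu> = sets borel" by fact
    show "sets (D \<Otimes>\<^sub>M fair_coin) = sets (borel \<Otimes>\<^sub>M borel)"
      by (intro sets_pair_measure_cong sets_D sets_fair_coin)
    fix a :: "real^'d::_" and b r :: real assume b: "b \<in> {0, 1}" and r: "r > 0"
    \<comment> \<open>A ball of mass zero would force the density to vanish almost everywhere on a
      set of positive Lebesgue measure.\<close>
    have "emeasure D (ball a r) \<noteq> 0"
    proof
      assume "emeasure D (ball a r) = 0"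
      hence "ball a r \<in> null_sets D" by (auto simp: null_sets_def sets_D)
      hence "AE \<xi> in lborel. \<xi> \<in> ball a r \<longrightarrow> ennreal (\<pi>\<^sub>a \<xi>) = 0"
        unfolding D_def by (subst (asm) null_sets_density_iff) auto
      hence "AE \<xi> in lborel. \<xi> \<notin> ball a r"
        using \<pi>_pos by simp
      hence "ball a r \<in> null_sets lborel"
        by (subst AE_iff_null_sets) auto
      hence "measure lborel (ball a r) = 0"
        by (simp add: null_sets_def measure_def)
      thus False using content_ball_pos[OF r, of a] by simp
    qed
    hence "measure D (ball a r) > 0" by (simp add: D.emeasure_eq_measure zero_less_measure_iff)
    moreover have "measure fair_coin {b} > 0"
      using emeasure_fair_coin[of "{b}"] b by (auto simp: measure_def indicator_def)
    moreover have "measure (D \<Otimes>\<^sub>M fair_coin) (ball a r \<times> {b}) = measure D (ball a r) * measure fair_coin {b}"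
      unfolding measure_def by (subst C.emeasure_pair_measure_Times)
        (auto simp: sets_D sets_fair_coin enn2real_mult)
    ultimately show "measure (D \<Otimes>\<^sub>M fair_coin) (ball a r \<times> {b}) > 0" by simp
  qed
  have "approximable f"
    using assms(3,4) by (rule approximable_square_integrable)
  \<comment> \<open>Bias and variance each get a quarter of the squared tolerance, since each is
    doubled when the error is split.\<close>
  moreover have "\<epsilon>\<^sup>2 / 4 > 0" using assms(12) by simp
  ultimately obtain g where "g \<in> feature_means (D \<Otimes>\<^sub>M fair_coin)"
      and g_close: "(\<integral>\<^sup>+x. ennreal ((g x - f x)\<^sup>2) \<partial>\<mu>) \<le> ennreal (\<epsilon>\<^sup>2 / 4)"
    by (rule approximableE)
  then obtain G K where G_meas: "G \<in> borel_measurable (D \<Otimes>\<^sub>M fair_coin)" and G_le: "\<And>z. \<bar>G z\<bar> \<le> K"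
      and g: "g = (\<lambda>x. \<integral>z. G z * feature z x \<partial>(D \<Otimes>\<^sub>M fair_coin))"
    unfolding feature_means_def by blast
  have [measurable]: "G \<in> borel_measurable (borel \<Otimes>\<^sub>M borel)"
    using G_meas by (simp add: measurable_cong_sets[OF sets_\<nu> refl])
  have [measurable]: "g \<in> borel_measurable \<mu>" "f \<in> borel_measurable \<mu>"
    using H_measurable[OF \<open>g \<in> _\<close>] assms(3) by auto
  \<comment> \<open>Solves \<open>(2 * K)^2 / n \<le> \<epsilon>^2 / 4\<close> for \<open>n\<close>;
    taking the successor ensures \<open>n \<ge> 1\<close> even when \<open>K = 0\<close>.\<close>
  obtain k where k: "16 * K\<^sup>2 / \<epsilon>\<^sup>2 \<le> real k" using real_arch_simple by blast
  define n where "n = Suc k"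
  have n: "n \<ge> 1" by (simp add: n_def)
  have "16 * K\<^sup>2 / \<epsilon>\<^sup>2 \<le> real n" using k by (simp add: n_def)
  hence n_large: "(2 * K)\<^sup>2 / real n \<le> \<epsilon>\<^sup>2 / 4"
    using n assms(12) by (simp add: field_simps power_mult_distrib)
  interpret P: qrnn_parameter_family M \<pi>\<^sub>a n "A n" "B n"
    by unfold_locales (use assms(10) n in auto)
  define Z where "Z i \<omega> = (A n i \<omega>, B n i \<omega>)" for i \<omega>
  have [measurable]: "Z i \<in> M \<rightarrow>\<^sub>M borel \<Otimes>\<^sub>M borel" if "i \<in> {1..n}" for i
    using P.measurable_pair[OF that] by (simp add: Z_def[abs_def])
  have Z_law: "distr M (borel \<Otimes>\<^sub>M borel) (Z i) = D \<Otimes>\<^sub>M fair_coin" if "i \<in> {1..n}" for i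
    using P.distr_pair[OF that] by (simp add: Z_def[abs_def] D_def)
  have Z_indep: "M.indep_vars (\<lambda>_. borel \<Otimes>\<^sub>M borel) Z {1..n}"
    using P.indep_vars_pairs by (simp add: Z_def[abs_def])
  define W where "W \<omega> = (\<lambda>j\<in>{..<n}. G (Z (j + 1) \<omega>))" for \<omega>
  define F where "F \<omega> x = (\<Sum>i\<in>{1..n}. G (Z i \<omega>) * feature (Z i \<omega>) x) / real n" for \<omega> x
  have F: "qrnn n (V n) (\<lambda>i. A n i \<omega>) (\<lambda>i. B n i \<omega>) (W \<omega>) x = F \<omega> x" for \<omega> x
    unfolding qrnn_eq_cosine_sum[OF n assms(11)[OF n]] F_def One_nat_def sum.atLeast1_atMost_eq
    by (auto simp: W_def Z_def feature_def intro!: sum.cong)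
  have W_meas: "W \<in> sigma_AB M n (A n) (B n) \<rightarrow>\<^sub>M PiM {..<n} (\<lambda>_. borel)"
  proof -
    let ?T = "\<lambda>\<omega>. (\<lambda>i\<in>{1..n}. A n i \<omega>, \<lambda>i\<in>{1..n}. B n i \<omega>)"
    have T: "?T \<in> sigma_AB M n (A n) (B n) \<rightarrow>\<^sub>M PiM {1..n} (\<lambda>_. borel) \<Otimes>\<^sub>M PiM {1..n} (\<lambda>_. borel)"
      unfolding sigma_AB_def
      by (rule measurable_vimage_algebra1) (auto simp: space_pair_measure space_PiM)
    have "Z i \<in> sigma_AB M n (A n) (B n) \<rightarrow>\<^sub>M borel \<Otimes>\<^sub>M borel" if i: "i \<in> {1..n}" for i
    proof -
      have "(\<lambda>\<omega>. (fst (?T \<omega>) i, snd (?T \<omega>) i)) \<in> sigma_AB M n (A n) (B n) \<rightarrow>\<^sub>M borel \<Otimes>\<^sub>M borel"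
      proof (rule measurable_Pair)
        show "(\<lambda>\<omega>. fst (?T \<omega>) i) \<in> borel_measurable (sigma_AB M n (A n) (B n))"
          by (rule measurable_compose[OF measurable_compose[OF T measurable_fst] measurable_component_singleton[OF i]])
        show "(\<lambda>\<omega>. snd (?T \<omega>) i) \<in> borel_measurable (sigma_AB M n (A n) (B n))"
          by (rule measurable_compose[OF measurable_compose[OF T measurable_snd] measurable_component_singleton[OF i]])
      qed
      thus ?thesis using i by (simp add: Z_def[abs_def])
    qed
    thus ?thesis unfolding W_def
      by (intro measurable_restrict measurable_compose[of "Z _" _ "borel \<Otimes>\<^sub>M borel" G]) auto
  qed
  have F_meas [measurable]: "case_prod F \<in> borel_measurable (M \<Otimes>\<^sub>M \<mu>)"
    unfolding F_def by measurable
  have F_meas' [measurable]: "(\<lambda>\<omega>. F \<omega> x) \<in> borel_measurable M" for x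
    unfolding F_def by measurable
  \<comment> \<open>At a fixed \<open>x\<close>, \<open>g x\<close> is the common mean of the
    summands. Their bound \<open>K\<close> does not depend on \<open>x\<close>, so one
    \<open>n\<close> serves all inputs.\<close>
  have bias_variance: "(\<integral>\<^sup>+\<omega>. ennreal ((F \<omega> x - f x)\<^sup>2) \<partial>M) \<le>
      ennreal (2 * (\<epsilon>\<^sup>2 / 4) + 2 * (g x - f x)\<^sup>2)" for x
  proof -
    have GF_le: "\<bar>G z * feature z x\<bar> \<le> K" for z
      using mult_mono[OF G_le[of z] abs_feature_le_1[of z x]] G_le[of z] by (simp add: abs_mult)
    have "(\<integral>\<^sup>+\<omega>. ennreal (((\<Sum>i\<in>{1..n}. G (Z i \<omega>) * feature (Z i \<omega>) x) / real (card {1..n}) - g x)\<^sup>2) \<partial>M)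
        \<le> ennreal ((2 * K)\<^sup>2 / real (card {1..n}))"
    proof (rule M.mean_square_error_sample_mean_le)
      show "M.indep_vars (\<lambda>_. borel) (\<lambda>i \<omega>. G (Z i \<omega>) * feature (Z i \<omega>) x) {1..n}"
        by (rule M.indep_vars_compose2[OF Z_indep]) measurable
      show "M.expectation (\<lambda>\<omega>. G (Z i \<omega>) * feature (Z i \<omega>) x) = g x" if i: "i \<in> {1..n}" for i
        unfolding g Z_law[OF i, symmetric] using i by (subst integral_distr) auto
    qed (use n GF_le in auto)
    also have "\<dots> \<le> ennreal (\<epsilon>\<^sup>2 / 4)"
      using n_large by (simp add: ennreal_leI)
    finally have "(\<integral>\<^sup>+\<omega>. ennreal ((F \<omega> x - g x)\<^sup>2) \<partial>M) \<le> ennreal (\<epsilon>\<^sup>2 / 4)"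
      by (simp add: F_def)
    hence "(\<integral>\<^sup>+\<omega>. ennreal (((F \<omega> x - g x) + (g x - f x))\<^sup>2) \<partial>M) \<le>
        ennreal (2 * (\<epsilon>\<^sup>2 / 4) + 2 * (g x - f x)\<^sup>2)"
      by (intro nn_integral_square_sum_le) (auto simp: M.emeasure_space_1)
    thus ?thesis by simp
  qed
  interpret M\<mu>: pair_sigma_finite M \<mu> ..
  define E where "E = (\<integral>\<^sup>+\<omega>. (\<integral>\<^sup>+x. ennreal (\<bar>F \<omega> x - f x\<bar>\<^sup>2) \<partial>\<mu>) \<partial>M)"
  have "E = (\<integral>\<^sup>+x. (\<integral>\<^sup>+\<omega>. ennreal ((F \<omega> x - f x)\<^sup>2) \<partial>M) \<partial>\<mu>)"
    unfolding E_def power2_abs by (rule M\<mu>.Fubini'[symmetric]) measurable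
  also have "\<dots> \<le> (\<integral>\<^sup>+x. ennreal (2 * (\<epsilon>\<^sup>2 / 4) + 2 * (g x - f x)\<^sup>2) \<partial>\<mu>)"
    by (intro nn_integral_mono bias_variance)
  also have "\<dots> = ennreal (2 * (\<epsilon>\<^sup>2 / 4)) + 2 * (\<integral>\<^sup>+x. ennreal ((g x - f x)\<^sup>2) \<partial>\<mu>)"
    by (simp add: ennreal_plus ennreal_mult nn_integral_add nn_integral_cmult \<mu>.emeasure_space_1)
  also have "\<dots> \<le> ennreal (2 * (\<epsilon>\<^sup>2 / 4)) + 2 * ennreal (\<epsilon>\<^sup>2 / 4)"
    by (intro add_left_mono mult_left_mono g_close) simp
  also have "\<dots> = ennreal (\<epsilon>\<^sup>2)"
  proof -
    have "2 * ennreal (\<epsilon>\<^sup>2 / 4) = ennreal (2 * (\<epsilon>\<^sup>2 / 4))"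
      using ennreal_mult[of 2 "\<epsilon>\<^sup>2 / 4"] by simp
    thus ?thesis by (simp add: ennreal_plus[symmetric] del: ennreal_plus)
  qed
  finally have E: "E \<le> ennreal (\<epsilon>\<^sup>2)" .
  \<comment> \<open>\<open>enn2real\<close> sends infinity to 0, so the bound on the root would be
    empty without this finiteness.\<close>
  have "E < \<infinity>" using E by (rule le_less_trans) simp
  moreover have "sqrt (enn2real E) \<le> \<epsilon>"
    using enn2real_mono[OF E] assms(12) by (intro real_le_lsqrt) auto
  ultimately show ?thesis
    using n W_meas unfolding Let_def by (intro exI[of _ n] conjI bexI[of _ W]) (simp_all add: F E_def)
qed

end
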